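(* Let $d$ be a positive integer. Suppose that the topological boundary of a bounded set $A\subseteq\mathbb{R}^d$ can be covered by countably many sets, each of which is a convex hypersurface or a regular $\mathcal{C}^2$ hypersurface in $\mathbb{R}^d$. Then $A$ is both distance Kolmogorov and measure Kolmogorov.
   Context: $\lambda$ denotes Lebesgue measure on $\mathbb{R}^d$, $|\cdot|$ the Euclidean norm. A set $P\subseteq\mathbb{R}^d$ is called a polyhedron if its topological boundary $\partial P$ can be covered by finitely many (affine) hyperplanes. A bounded measurable set $A\subseteq\mathbb{R}^d$ is measure Kolmogorov if for every $\varepsilon>0$ there is a 1-Lipschitz map $f:A\to\mathbb{R}^d$ such that $f(A)$ is a polyhedron and $\lambda(f(A))>\lambda(A)-\varepsilon$. A bounded set $A\subseteq\mathbb{R}^d$ is distance Kolmogorov if for every $\varepsilon>0$ there is a 1-Lipschitz map $f:A\to\mathbb{R}^d$ such that $f(A)$ is a polyhedron and $|f(x)-x|\le\varepsilon$ for every $x\in A$. A convex hypersurface in $\mathbb{R}^d$ is (a subset of) the boundary of a convex subset of $\mathbb{R}^d$. A regular $\mathcal{C}^2$ hypersurface is a set of the form $F(U)$, where $U\subseteq\mathbb{R}^{d-1}$ is open and $F\in\mathcal{C}^2(U,\mathbb{R}^d)$ has derivative $F'$ of rank $d-1$ everywhere. *)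

theory Defs
  imports "HOL-Analysis.Analysis"
begin

definition affine_hyperplane :: "'a::euclidean_space set \<Rightarrow> bool" where
  "affine_hyperplane H \<longleftrightarrow> (\<exists>a c. a \<noteq> 0 \<and> H = {x. a \<bullet> x = c})"

text \<open>This is much weaker than the library predicate \<^const>\<open>polyhedron\<close>, which
  requires a finite intersection of half-spaces: the set need be neither convex nor closed.\<close>

definition polyhedral_boundary :: "'a::euclidean_space set \<Rightarrow> bool" where
  "polyhedral_boundary P \<longleftrightarrow>
     (\<exists>\<H>. finite \<H> \<and> (\<forall>H\<in>\<H>. affine_hyperplane H) \<and> frontier P \<subseteq> \<Union>\<H>)"

text \<open>Bounded sets and their Lipschitz images have finite outer measure, and
  \<^term>\<open>f ` A\<close> is Lebesgue measurable because its frontier is negligible, so the real-valued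
  \<^const>\<open>measure\<close> below is the genuine Lebesgue measure.\<close>

definition measure_Kolmogorov :: "'a::euclidean_space set \<Rightarrow> bool" where
  "measure_Kolmogorov A \<longleftrightarrow>
     bounded A \<and> A \<in> sets lebesgue \<and>
     (\<forall>\<epsilon>>0. \<exists>f::'a \<Rightarrow> 'a. 1-lipschitz_on A f \<and> polyhedral_boundary (f ` A) \<and>
        measure lebesgue (f ` A) > measure lebesgue A - \<epsilon>)"

definition distance_Kolmogorov :: "'a::euclidean_space set \<Rightarrow> bool" where
  "distance_Kolmogorov A \<longleftrightarrow>
     bounded A \<and>
     (\<forall>\<epsilon>>0. \<exists>f::'a \<Rightarrow> 'a. 1-lipschitz_on A f \<and> polyhedral_boundary (f ` A) \<and>
        (\<forall>x\<in>A. norm (f x - x) \<le> \<epsilon>))"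

definition convex_hypersurface :: "'a::euclidean_space set \<Rightarrow> bool" where
  "convex_hypersurface S \<longleftrightarrow> (\<exists>C. convex C \<and> S \<subseteq> frontier C)"

definition C2_with_derivative ::
    "('a::real_normed_vector \<Rightarrow> 'b::real_normed_vector) \<Rightarrow> ('a \<Rightarrow> 'a \<Rightarrow>\<^sub>L 'b) \<Rightarrow> 'a set \<Rightarrow> bool"
  where
  "C2_with_derivative F F' U \<longleftrightarrow>
     (\<forall>x\<in>U. (F has_derivative blinfun_apply (F' x)) (at x within U)) \<and>
     (\<exists>F''. (\<forall>x\<in>U. (F' has_derivative blinfun_apply (F'' x)) (at x within U)) \<and>
            continuous_on U F'')"

text \<open>The parameter space of dimension \<^term>\<open>DIM('a::euclidean_space) - 1\<close> is realised as a
  linear hyperplane \<^term>\<open>V\<close> of the ambient space (a type of dimension 0 would be needed for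
  \<open>d = 1\<close>, and \<^class>\<open>euclidean_space\<close> has none), so \<^term>\<open>U\<close> is open relative to
  \<^term>\<open>V\<close>.  Derivatives within \<^term>\<open>U\<close> are determined only on \<^term>\<open>V\<close>.  Their values
  off \<^term>\<open>V\<close> are irrelevant: one may always precompose with the orthogonal projection onto
  \<^term>\<open>V\<close>, and the rank is that of the restriction to \<^term>\<open>V\<close>.\<close>

definition regular_C2_hypersurface :: "'a::euclidean_space set \<Rightarrow> bool" where
  "regular_C2_hypersurface S \<longleftrightarrow>
     (\<exists>V U (F::'a \<Rightarrow> 'a) F'.
        subspace V \<and> dim V = DIM('a) - 1 \<and> openin (top_of_set V) U \<and>
        C2_with_derivative F F' U \<and>
        (\<forall>x\<in>U. dim (blinfun_apply (F' x) ` V) = DIM('a) - 1) \<and>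
        S = F ` U)"

end

theory Submission imports Defs begin

text \<open>
  The proximal map of a piecewise linear convex function \<open>\<phi>\<close> is surjective and 1-Lipschitz, and moves
  points by at most the Lipschitz constant of \<open>\<phi>\<close>. Over the complement of the creases of \<open>\<phi>\<close>,
  which lie in finitely many hyperplanes, it is locally a translation; so the frontier of the image of
  a set is contained in the creases and the image of the frontier of the set. It therefore suffices to
  map the frontier of \<open>A\<close> into finitely many hyperplanes by compositions of such maps.

  Near a boundary point of a convex body, or near a point of a regular \<open>C\<^sup>2\<close> hypersurface, the hypersurface
  is part of the coincidence set of two convex functions whose gradients point to opposite sides:
  suprema of affine functions given by the supporting half-spaces, respectively by balls touching from
  either side. By compactness finitely many of these affine functions yield, after multiplication by a small
  constant, a \<open>\<phi>\<close> whose proximal map sends a neighbourhood of the piece into the creases. Such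
  pieces are treated one after another with displacements of finite sum: a later piece has only been
  cut into finitely many translated parts and parts in hyperplanes. Compactness of the frontier stops
  the process after finitely many steps.

  Measure is almost preserved because a surjection with displacement less than \<open>r\<close> maps \<open>A\<close> onto a
  superset of all points at distance at least \<open>r\<close> from the complement of \<open>A\<close>.
\<close>

section \<open>Flat sets and foldings\<close>

definition flat :: "'a::euclidean_space set \<Rightarrow> bool" where
  "flat X \<longleftrightarrow> (\<exists>\<H>. finite \<H> \<and> (\<forall>H\<in>\<H>. affine_hyperplane H) \<and> X \<subseteq> \<Union>\<H>)"

lemma flat_subset: "flat Y \<Longrightarrow> X \<subseteq> Y \<Longrightarrow> flat X"
  unfolding flat_def by (meson order_trans)

lemma flat_Union:
  assumes "finite F" "\<And>X. X \<in> F \<Longrightarrow> flat X"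
  shows "flat (\<Union>F)"
proof -
  obtain h where h: "\<And>X. X \<in> F \<Longrightarrow> finite (h X) \<and> (\<forall>H\<in>h X. affine_hyperplane H) \<and> X \<subseteq> \<Union>(h X)"
    using assms(2) unfolding flat_def by metis
  have "X \<subseteq> \<Union>(\<Union>(h ` F))" if "X \<in> F" for X
  proof -
    have "h X \<subseteq> \<Union>(h ` F)" using that by blast
    then show ?thesis using h[OF that] by (meson Union_mono order_trans)
  qed
  then have "\<Union>F \<subseteq> \<Union>(\<Union>(h ` F))" by (rule Union_least)
  then show ?thesis
    unfolding flat_def using assms(1) h by (intro exI[of _ "\<Union>(h ` F)"]) auto
qed

lemma flat_empty: "flat {}"
  using flat_Union[of "{}"] by simp

lemma flat_Un: "flat X \<Longrightarrow> flat Y \<Longrightarrow> flat (X \<union> Y)"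
  using flat_Union[of "{X, Y}"] by auto

lemma flat_hyperplane: "a \<noteq> 0 \<Longrightarrow> flat {x. a \<bullet> x = c}"
  unfolding flat_def affine_hyperplane_def by (intro exI[of _ "{{x. a \<bullet> x = c}}"]) auto

lemma flat_translation:
  assumes "flat X" shows "flat ((+) d ` X)"
proof -
  obtain \<H> where H: "finite \<H>" "\<forall>H\<in>\<H>. affine_hyperplane H" "X \<subseteq> \<Union>\<H>"
    using assms unfolding flat_def by (meson order_trans)
  have "affine_hyperplane ((+) d ` H)" if "H \<in> \<H>" for H
  proof -
    have "\<exists>a c. a \<noteq> 0 \<and> H = {x. a \<bullet> x = c}"
      using H(2)[rule_format, OF that] unfolding affine_hyperplane_def .
    then obtain a c where ac: "a \<noteq> 0" "H = {x. a \<bullet> x = c}" by (elim exE conjE)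
    have "(+) d ` H = {x. a \<bullet> x = c + a \<bullet> d}"
    proof (intro equalityI subsetI)
      fix x assume "x \<in> {x. a \<bullet> x = c + a \<bullet> d}"
      then have "x - d \<in> H" by (simp add: ac inner_diff_right)
      then show "x \<in> (+) d ` H" by (intro image_eqI[of _ _ "x - d"]) auto
    qed (auto simp: ac inner_add_right)
    then show ?thesis using ac(1) unfolding affine_hyperplane_def by blast
  qed
  moreover have "(+) d ` X \<subseteq> \<Union>((`) ((+) d) ` \<H>)"
    using image_mono[OF H(3), of "(+) d"] by (simp only: image_Union)
  ultimately show ?thesis
    unfolding flat_def using H(1) by (intro exI[of _ "(`) ((+) d) ` \<H>"]) simp
qed

lemma negligible_flat:
  assumes "flat X" shows "negligible X"
proof -
  obtain \<H> where H: "finite \<H>" "\<forall>H\<in>\<H>. affine_hyperplane H" "X \<subseteq> \<Union>\<H>"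
    using assms unfolding flat_def by (meson order_trans)
  have "negligible (\<Union>\<H>)"
    using H by (intro negligible_Union) (auto simp: affine_hyperplane_def negligible_hyperplane)
  then show ?thesis using H(3) negligible_subset by blast
qed

text \<open>These are the properties of proximal maps that survive composition. Having finitely many
  displacements off \<open>Z\<close> makes images of flat sets flat, and the frontier clause reduces
  the task to flattening the frontier of the given set.\<close>

definition folding :: "('a::euclidean_space \<Rightarrow> 'a) \<Rightarrow> bool" where
  "folding f \<longleftrightarrow> 1-lipschitz_on UNIV f \<and> surj f \<and>
     (\<exists>Z D. flat Z \<and> finite D \<and> (\<forall>x. f x \<in> Z \<or> f x - x \<in> D) \<and>
            (\<forall>A. frontier (f ` A) \<subseteq> Z \<union> f ` frontier A))"

lemma folding_lipschitz: "folding f \<Longrightarrow> 1-lipschitz_on UNIV f"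
  and folding_surj: "folding f \<Longrightarrow> surj f"
  unfolding folding_def by simp_all

lemma folding_flat_image:
  assumes "folding f" "flat X" shows "flat (f ` X)"
proof -
  obtain Z D where ZD: "flat Z" "finite D" "\<And>x. f x \<in> Z \<or> f x - x \<in> D"
    using assms(1) unfolding folding_def by blast
  have "f ` X \<subseteq> Z \<union> \<Union>((\<lambda>d. (+) d ` X) ` D)"
  proof
    fix y assume "y \<in> f ` X"
    then obtain x where x: "x \<in> X" "y = f x" by auto
    then have "y \<in> Z \<or> (y - x \<in> D \<and> y \<in> (+) (y - x) ` X)" using ZD(3)[of x] by auto
    then show "y \<in> Z \<union> \<Union>((\<lambda>d. (+) d ` X) ` D)" by blast
  qed
  moreover have "flat (Z \<union> \<Union>((\<lambda>d. (+) d ` X) ` D))"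
    using ZD assms(2) by (intro flat_Un flat_Union) (auto intro: flat_translation)
  ultimately show ?thesis by (rule flat_subset[rotated])
qed

lemma folding_id: "folding id"
proof -
  have "1-lipschitz_on UNIV (id :: 'a::euclidean_space \<Rightarrow> 'a)"
    by (simp add: lipschitz_on_def)
  then show ?thesis unfolding folding_def
    by (intro conjI exI[of _ "{}"] exI[of _ "{0}"]) (auto simp: flat_empty)
qed

text \<open>Points whose images avoid both \<open>Z\<close> and \<open>Y\<close> are moved by a sum
  of one displacement from \<open>D\<close> and one from \<open>E\<close>. All other points end in
  \<open>Y\<close> or in the image of \<open>Z\<close> under \<open>g\<close>, which is flat because
  \<open>g\<close> is a folding.\<close>

lemma folding_compose:
  assumes f: "folding f" and g: "folding g" shows "folding (g \<circ> f)"
proof -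
  obtain Z D where ZD: "flat Z" "finite D" "\<And>x. f x \<in> Z \<or> f x - x \<in> D"
      "\<And>A. frontier (f ` A) \<subseteq> Z \<union> f ` frontier A"
    using f unfolding folding_def by metis
  obtain Y E where YE: "flat Y" "finite E" "\<And>x. g x \<in> Y \<or> g x - x \<in> E"
      "\<And>A. frontier (g ` A) \<subseteq> Y \<union> g ` frontier A"
    using g unfolding folding_def by metis
  have "1-lipschitz_on UNIV (g \<circ> f)"
    using lipschitz_on_compose[of 1 UNIV f 1 g] folding_lipschitz[OF f]
      lipschitz_on_subset[OF folding_lipschitz[OF g] subset_UNIV] by simp
  moreover have "surj (g \<circ> f)" using folding_surj[OF f] folding_surj[OF g] by (rule comp_surj)
  moreover have "flat (Y \<union> g ` Z)" using YE(1) ZD(1) g by (simp add: flat_Un folding_flat_image)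
  moreover have "finite ((\<lambda>(d, e). d + e) ` (D \<times> E))" using ZD(2) YE(2) by simp
  moreover have "(g \<circ> f) x \<in> Y \<union> g ` Z \<or> (g \<circ> f) x - x \<in> (\<lambda>(d, e). d + e) ` (D \<times> E)" for x
  proof (cases "f x \<in> Z \<or> g (f x) \<in> Y")
    case False
    then have "f x - x \<in> D" "g (f x) - f x \<in> E" using ZD(3) YE(3) by auto
    then show ?thesis
      by (intro disjI2 image_eqI[of _ _ "(f x - x, g (f x) - f x)"]) auto
  qed auto
  moreover have "frontier ((g \<circ> f) ` A) \<subseteq> (Y \<union> g ` Z) \<union> (g \<circ> f) ` frontier A" for A
  proof -
    have "frontier ((g \<circ> f) ` A) \<subseteq> Y \<union> g ` frontier (f ` A)"
      using YE(4)[of "f ` A"] by (simp add: image_comp)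
    also have "\<dots> \<subseteq> Y \<union> g ` (Z \<union> f ` frontier A)" using ZD(4)[of A] by (intro Un_mono image_mono) auto
    finally show ?thesis by (simp add: image_Un image_comp Un_assoc)
  qed
  ultimately show ?thesis unfolding folding_def by blast
qed

section \<open>Proximal maps of piecewise linear convex functions\<close>

abbreviation affine_val :: "'a::euclidean_space \<times> real \<Rightarrow> 'a \<Rightarrow> real" where
  "affine_val p y \<equiv> fst p \<bullet> y - snd p"

definition plin :: "('a::euclidean_space \<times> real) set \<Rightarrow> 'a \<Rightarrow> real" where
  "plin I y = Max ((\<lambda>p. affine_val p y) ` I)"

definition crease :: "('a::euclidean_space \<times> real) set \<Rightarrow> 'a set" where
  "crease I = {y. \<exists>p\<in>I. \<exists>q\<in>I. p \<noteq> q \<and> affine_val p y = plin I y \<and> affine_val q y = plin I y}"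

lemma flat_crease:
  assumes "finite I" shows "flat (crease I)"
proof -
  let ?H = "\<lambda>r. {y. (fst (fst r) - fst (snd r)) \<bullet> y = snd (fst r) - snd (snd r)}"
  let ?J = "{r \<in> I \<times> I. fst (fst r) \<noteq> fst (snd r)}"
  have "crease I \<subseteq> \<Union>(?H ` ?J)"
  proof
    fix y assume "y \<in> crease I"
    then obtain p q where pq: "p \<in> I" "q \<in> I" "p \<noteq> q"
        "affine_val p y = plin I y" "affine_val q y = plin I y"
      unfolding crease_def by blast
    \<comment> \<open>Equal gradients together with equal values at \<open>y\<close> would force
      equal offsets, hence \<open>p = q\<close>. So the coincidence set of the two pieces is a
      genuine hyperplane.\<close>
    then have "fst p \<noteq> fst q" by (metis diff_left_imp_eq prod_eqI)
    then have "(p, q) \<in> ?J" using pq by simp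
    moreover have "y \<in> ?H (p, q)" using pq by (simp add: inner_diff_left)
    ultimately show "y \<in> \<Union>(?H ` ?J)" by (rule UN_I)
  qed
  moreover have "flat (\<Union>(?H ` ?J))"
  proof (rule flat_Union)
    show "finite (?H ` ?J)" using assms by simp
    show "flat X" if "X \<in> ?H ` ?J" for X
    proof -
      have "\<exists>r\<in>?J. X = ?H r" using that by (simp only: image_iff)
      then obtain r where "r \<in> ?J" "X = ?H r" by (rule bexE)
      then show ?thesis by (simp add: flat_hyperplane)
    qed
  qed
  ultimately show ?thesis by (rule flat_subset[rotated])
qed

context
  fixes I :: "('a::euclidean_space \<times> real) set"
  assumes fin: "finite I" and ne: "I \<noteq> {}"
begin

lemma affine_val_le_plin: "p \<in> I \<Longrightarrow> affine_val p y \<le> plin I y"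
  unfolding plin_def using fin by simp

lemma plin_active: obtains p where "p \<in> I" "affine_val p y = plin I y"
proof -
  have "plin I y \<in> (\<lambda>p. affine_val p y) ` I" using fin ne unfolding plin_def by (intro Max_in) auto
  then have "\<exists>p\<in>I. plin I y = affine_val p y" by (simp only: image_iff)
  then obtain p where "p \<in> I" "plin I y = affine_val p y" by (rule bexE)
  then show ?thesis using that by presburger
qed

lemma plin_lipschitz:
  assumes "\<And>p. p \<in> I \<Longrightarrow> norm (fst p) \<le> L"
  shows "plin I y \<le> plin I z + L * norm (y - z)"
proof -
  obtain p where p: "p \<in> I" "affine_val p y = plin I y" by (rule plin_active)
  have "fst p \<bullet> (y - z) \<le> norm (fst p) * norm (y - z)" by (rule norm_cauchy_schwarz)
  also have "\<dots> \<le> L * norm (y - z)" using assms[OF p(1)] by (simp add: mult_right_mono)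
  finally show ?thesis using p affine_val_le_plin[OF p(1), of z] by (simp add: inner_diff_right)
qed

lemma plin_convex:
  assumes "0 \<le> t" "t \<le> 1"
  shows "plin I (y + t *\<^sub>R (z - y)) \<le> plin I y + t * (plin I z - plin I y)"
proof -
  obtain p where p: "p \<in> I" "affine_val p (y + t *\<^sub>R (z - y)) = plin I (y + t *\<^sub>R (z - y))"
    by (rule plin_active)
  have "affine_val p (y + t *\<^sub>R (z - y)) = (1 - t) * affine_val p y + t * affine_val p z"
    by (simp add: inner_add_right inner_diff_right algebra_simps)
  also have "\<dots> \<le> (1 - t) * plin I y + t * plin I z"
    using assms by (intro add_mono mult_left_mono affine_val_le_plin[OF p(1)]) simp_all
  also have "\<dots> = plin I y + t * (plin I z - plin I y)" by (simp add: algebra_simps)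
  finally show ?thesis unfolding p(2) .
qed

text \<open>The point \<open>y\<close> is the minimiser of \<open>plin I y + |x - y|\<^sup>2 / 2\<close>; it is characterised by \<open>x - y\<close> being a
  subgradient at \<open>y\<close>, which is the only property used.\<close>

lemma prox_exists:
  obtains y where "\<And>z. plin I z \<ge> plin I y + (x - y) \<bullet> (z - y)"
proof -
  \<comment> \<open>This is a Lipschitz constant of \<open>plin I\<close>. Beyond distance
    \<open>2 * L\<close> from \<open>x\<close> the quadratic term outweighs any decrease of
    \<open>plin I\<close>, so the minimum over that ball is global.\<close>
  define L where "L = Max ((\<lambda>p. norm (fst p)) ` I)"
  have L: "norm (fst p) \<le> L" if "p \<in> I" for p unfolding L_def using fin that by simp
  obtain p0 where "p0 \<in> I" using ne by blast
  then have "0 \<le> L" using L[of p0] norm_ge_zero order_trans by blast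
  have lip: "\<bar>plin I y - plin I z\<bar> \<le> L * norm (y - z)" for y z
    using plin_lipschitz[of L y z] plin_lipschitz[of L z y] L
    by (simp add: norm_minus_commute abs_le_iff)
  then have "L-lipschitz_on UNIV (plin I)"
    using \<open>0 \<le> L\<close> by (intro lipschitz_onI) (auto simp: dist_norm)
  then have "continuous_on UNIV (plin I)" by (rule lipschitz_on_continuous_on)
  then have "continuous_on (cball x (2 * L)) (plin I)" by (rule continuous_on_subset) simp
  then have cont: "continuous_on (cball x (2 * L)) (\<lambda>y. plin I y + (norm (x - y))\<^sup>2 / 2)"
    by (intro continuous_intros) simp_all
  obtain y where y: "y \<in> cball x (2 * L)"
      "\<And>z. z \<in> cball x (2 * L) \<Longrightarrow> plin I y + (norm (x - y))\<^sup>2 / 2 \<le> plin I z + (norm (x - z))\<^sup>2 / 2"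
    using continuous_attains_inf[OF compact_cball _ cont] \<open>0 \<le> L\<close> by auto
  have min: "plin I y + (norm (x - y))\<^sup>2 / 2 \<le> plin I z + (norm (x - z))\<^sup>2 / 2" for z
  proof (cases "norm (x - z) \<le> 2 * L")
    case False
    have "2 * L * norm (x - z) \<le> norm (x - z) * norm (x - z)"
      using False by (intro mult_right_mono) auto
    then have "plin I x \<le> plin I z + (norm (x - z))\<^sup>2 / 2"
      using lip[of x z] by (simp add: power2_eq_square)
    moreover have "plin I y + (norm (x - y))\<^sup>2 / 2 \<le> plin I x"
      using y(2)[of x] \<open>0 \<le> L\<close> by simp
    ultimately show ?thesis by simp
  qed (use y(2) in \<open>auto simp: dist_norm\<close>)
  have "plin I z \<ge> plin I y + (x - y) \<bullet> (z - y)" for z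
  proof (rule ccontr)
    let ?d = "plin I y + (x - y) \<bullet> (z - y) - plin I z"
    assume "\<not> ?thesis"
    then have d: "?d > 0" by simp
    \<comment> \<open>For so short a step from \<open>y\<close> towards \<open>z\<close> the
      first-order decrease \<open>t * ?d\<close> exceeds the second-order increase, contradicting
      minimality. The \<open>min\<close> keeps the point on the segment.\<close>
    define t where "t = min 1 (?d / ((norm (z - y))\<^sup>2 + 1))"
    have t: "0 < t" "t \<le> 1" unfolding t_def using d by (auto intro!: divide_pos_pos add_nonneg_pos)
    have "t \<le> ?d / ((norm (z - y))\<^sup>2 + 1)" unfolding t_def by simp
    then have "t * ((norm (z - y))\<^sup>2 + 1) \<le> ?d"
      by (simp add: pos_le_divide_eq add_nonneg_pos)
    then have td: "t * (norm (z - y))\<^sup>2 < 2 * ?d" using t d by (simp add: algebra_simps)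
    have eq: "(norm (x - (y + t *\<^sub>R (z - y))))\<^sup>2
        = (norm (x - y))\<^sup>2 - 2 * t * ((x - y) \<bullet> (z - y)) + t * (t * (norm (z - y))\<^sup>2)"
      unfolding power2_norm_eq_inner by (simp add: inner_simps inner_commute algebra_simps)
    have "0 \<le> t * (plin I z - plin I y) - t * ((x - y) \<bullet> (z - y)) + t * (t * (norm (z - y))\<^sup>2) / 2"
      using min[of "y + t *\<^sub>R (z - y)"] plin_convex[of t y z] t unfolding eq
      by (simp add: add_divide_distrib diff_divide_distrib)
    also have "\<dots> = t * (t * (norm (z - y))\<^sup>2 / 2 - ?d)" by (simp add: algebra_simps)
    also have "\<dots> < 0" using td t by (simp add: mult_pos_neg)
    finally show False by simp
  qed
  then show ?thesis using that by blast
qed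

text \<open>Off the crease a single piece attains the maximum. Since there are finitely many pieces,
  all continuous, it keeps its strict lead on a ball.\<close>

lemma unique_active_nbhd:
  assumes "y \<notin> crease I"
  obtains p e where "p \<in> I" "e > 0" "affine_val p y = plin I y"
    "\<And>z q. dist z y < e \<Longrightarrow> q \<in> I \<Longrightarrow> q \<noteq> p \<Longrightarrow> affine_val q z < affine_val p z"
proof -
  obtain p where p: "p \<in> I" "affine_val p y = plin I y" by (rule plin_active)
  have less: "affine_val q y < affine_val p y" if "q \<in> I" "q \<noteq> p" for q
    using assms p that affine_val_le_plin[of q y] unfolding crease_def by force
  have "eventually (\<lambda>z. \<forall>q\<in>I - {p}. affine_val q z < affine_val p z) (nhds y)"
  proof (rule eventually_ball_finite)
    show "\<forall>q\<in>I - {p}. eventually (\<lambda>z. affine_val q z < affine_val p z) (nhds y)"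
    proof
      fix q assume "q \<in> I - {p}"
      then have "0 < affine_val p y - affine_val q y" using less by simp
      moreover have "((\<lambda>z. affine_val p z - affine_val q z) \<longlongrightarrow> affine_val p y - affine_val q y) (nhds y)"
        by (intro tendsto_intros filterlim_ident)
      ultimately have "eventually (\<lambda>z. 0 < affine_val p z - affine_val q z) (nhds y)"
        by (rule order_tendstoD(1)[rotated])
      then show "eventually (\<lambda>z. affine_val q z < affine_val p z) (nhds y)" by simp
    qed
  qed (use fin in simp)
  then obtain e where "e > 0"
      "\<And>z q. dist z y < e \<Longrightarrow> q \<in> I \<Longrightarrow> q \<noteq> p \<Longrightarrow> affine_val q z < affine_val p z"
    unfolding eventually_nhds_metric by auto
  then show ?thesis using that p by blast
qed

text \<open>Near \<open>y\<close> the function \<open>plin I\<close> is affine, so the gradient of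
  its one active piece is the only subgradient.\<close>

lemma subgradient_off_crease:
  assumes sub: "\<And>z. plin I z \<ge> plin I y + g \<bullet> (z - y)" and "y \<notin> crease I"
  obtains p where "p \<in> I" "g = fst p" "\<And>q. q \<in> I \<Longrightarrow> q \<noteq> p \<Longrightarrow> affine_val q y < affine_val p y"
proof -
  obtain p e where p: "p \<in> I" "affine_val p y = plin I y" and e: "e > 0"
      "\<And>z q. dist z y < e \<Longrightarrow> q \<in> I \<Longrightarrow> q \<noteq> p \<Longrightarrow> affine_val q z < affine_val p z"
    using unique_active_nbhd[OF assms(2)] by metis
  have "g = fst p"
  proof (rule ccontr)
    assume "g \<noteq> fst p"
    define h where "h = g - fst p"
    have h: "h \<noteq> 0" using \<open>g \<noteq> fst p\<close> unfolding h_def by simp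
    \<comment> \<open>A step in the direction in which \<open>g\<close> and \<open>fst p\<close>
      disagree, of half the radius on which \<open>p\<close> leads.\<close>
    define z where "z = y + (e / (2 * norm h)) *\<^sub>R h"
    have z: "dist z y < e" using h e(1) unfolding z_def by (auto simp: dist_norm)
    obtain q where q: "q \<in> I" "affine_val q z = plin I z" by (rule plin_active)
    then have "plin I z = affine_val p z"
      using e(2)[OF z, of q] affine_val_le_plin[OF p(1), of z] by (cases "q = p") auto
    then have "fst p \<bullet> (z - y) \<ge> g \<bullet> (z - y)"
      using sub[of z] p(2) by (simp add: inner_diff_right)
    then have "h \<bullet> (z - y) \<le> 0" unfolding h_def by (simp add: inner_diff_left)
    moreover have "h \<bullet> (z - y) > 0" using h e(1) unfolding z_def by simp
    ultimately show False by simp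
  qed
  then show ?thesis using p(1) that e(2)[of y] e(1) by simp
qed

text \<open>The piece leading near \<open>y\<close> is the only active one at every image point near
  \<open>y\<close>, so its gradient is the displacement of all points landing there.\<close>

lemma off_crease_translation:
  assumes sub: "\<And>x z. plin I z \<ge> plin I (f x) + (x - f x) \<bullet> (z - f x)" and "y \<notin> crease I"
  obtains v e where "e > 0" "\<And>x. dist (f x) y < e \<Longrightarrow> x - f x = v"
proof -
  obtain p e where p: "p \<in> I" and e: "e > 0"
      "\<And>z q. dist z y < e \<Longrightarrow> q \<in> I \<Longrightarrow> q \<noteq> p \<Longrightarrow> affine_val q z < affine_val p z"
    using unique_active_nbhd[OF assms(2)] by metis
  have "x - f x = fst p" if "dist (f x) y < e" for x
  proof -
    have "affine_val q (f x) = plin I (f x) \<Longrightarrow> q = p" if "q \<in> I" for q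
      using e(2)[OF \<open>dist (f x) y < e\<close> that] affine_val_le_plin[OF p, of "f x"] by force
    then have "f x \<notin> crease I" unfolding crease_def by blast
    then obtain r where r: "r \<in> I" "x - f x = fst r"
        "\<And>q. q \<in> I \<Longrightarrow> q \<noteq> r \<Longrightarrow> affine_val q (f x) < affine_val r (f x)"
      using subgradient_off_crease[of "f x" "x - f x"] sub by blast
    then have "r = p" using e(2)[OF that, of r] p by (metis less_asym)
    then show ?thesis using r by simp
  qed
  then show ?thesis using that e(1) by blast
qed

text \<open>Adding the subgradient inequalities at \<open>f x\<close> and \<open>f w\<close>, each
  tested at the other point, gives monotonicity of the subdifferential; Cauchy-Schwarz does the
  rest.\<close>

lemma prox_nonexpansive:
  assumes sub: "\<And>x z. plin I z \<ge> plin I (f x) + (x - f x) \<bullet> (z - f x)"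
  shows "1-lipschitz_on UNIV f"
proof (rule lipschitz_onI)
  fix x w
  have "(norm (f x - f w))\<^sup>2 \<le> (x - w) \<bullet> (f x - f w)"
    using sub[where x=x and z="f w"] sub[where x=w and z="f x"]
    unfolding power2_norm_eq_inner by (simp add: inner_simps inner_commute algebra_simps)
  also have "\<dots> \<le> norm (x - w) * norm (f x - f w)" by (rule norm_cauchy_schwarz)
  finally show "dist (f x) (f w) \<le> 1 * dist x w"
    unfolding dist_norm power2_eq_square
    by (cases "norm (f x - f w) = 0") (auto simp: mult_le_cancel_right)
qed simp

text \<open>Tested at \<open>x\<close>, the subgradient inequality bounds the squared displacement
  by the growth of \<open>plin I\<close> from \<open>f x\<close> to \<open>x\<close>, which is at
  most \<open>L\<close> times the displacement.\<close>

lemma prox_displacement: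
  assumes sub: "\<And>x z. plin I z \<ge> plin I (f x) + (x - f x) \<bullet> (z - f x)"
    and L: "\<And>p. p \<in> I \<Longrightarrow> norm (fst p) \<le> L"
  shows "norm (f x - x) \<le> L"
proof -
  have "(norm (x - f x))\<^sup>2 \<le> L * norm (x - f x)"
    using sub[where x=x and z=x] plin_lipschitz[OF L, of x "f x"] unfolding power2_norm_eq_inner by simp
  moreover have "0 \<le> L" using ne L norm_ge_zero order_trans by (metis all_not_in_conv)
  ultimately show ?thesis
    unfolding power2_eq_square norm_minus_commute[of "f x" x]
    by (cases "norm (x - f x) = 0") (auto simp: mult_le_cancel_right)
qed

lemma prox_folding:
  assumes sub: "\<And>x z. plin I z \<ge> plin I (f x) + (x - f x) \<bullet> (z - f x)"
  shows "folding f"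
proof -
  have "surj f"
  proof -
    have "\<exists>x. f x = y" for y
    proof -
      obtain p where p: "p \<in> I" "affine_val p y = plin I y" by (rule plin_active)
      \<comment> \<open>The gradient of an active piece is a subgradient at \<open>y\<close>, so
        \<open>y\<close> satisfies the condition that characterises \<open>f x\<close>. The two
        subgradient inequalities then force \<open>f x = y\<close>.\<close>
      define x where "x = y + fst p"
      have "plin I (f x) \<ge> plin I y + (x - y) \<bullet> (f x - y)"
        using affine_val_le_plin[OF p(1), of "f x"] p(2) by (simp add: x_def inner_simps)
      then have "(norm (f x - y))\<^sup>2 \<le> 0"
        using sub[where x=x and z=y] unfolding power2_norm_eq_inner by (simp add: inner_simps inner_commute algebra_simps)
      then have "f x = y" by simp
      then show ?thesis by blast
    qed
    then show ?thesis by (metis surjI)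
  qed
  moreover have "f x \<in> crease I \<or> f x - x \<in> (\<lambda>p. - fst p) ` I" for x
  proof (cases "f x \<in> crease I")
    case False
    then obtain p where "p \<in> I" "x - f x = fst p"
      using subgradient_off_crease[of "f x" "x - f x"] sub by blast
    then show ?thesis by (intro disjI2 image_eqI[of _ _ p]) (auto simp: algebra_simps)
  qed simp
  moreover have "frontier (f ` A) \<subseteq> crease I \<union> f ` frontier A" for A
  proof
    fix y assume y: "y \<in> frontier (f ` A)"
    show "y \<in> crease I \<union> f ` frontier A"
    proof (cases "y \<in> crease I")
      case False
      obtain v e where e: "e > 0" "\<And>x. dist (f x) y < e \<Longrightarrow> x - f x = v"
        using off_crease_translation[OF sub False] by metis
      \<comment> \<open>By surjectivity every \<open>w\<close> near \<open>y\<close> has a preimage,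
        and the only candidate is \<open>w + v\<close>. Hence points near \<open>y\<close> outside
        the image of \<open>A\<close> translate to points outside \<open>A\<close>, just as image
        points translate to points of \<open>A\<close>.\<close>
      have pre: "f (w + v) = w" if w: "dist w y < e" for w
      proof -
        obtain x where "f x = w" using \<open>surj f\<close> by (metis surjD)
        then show ?thesis using e(2)[of x] w by (metis add.commute diff_add_cancel)
      qed
      have "y + v \<in> frontier A"
        unfolding frontier_straddle mem_Collect_eq
      proof (intro allI impI conjI)
        fix r :: real assume "r > 0"
        then have r: "min r e > 0" using e(1) by simp
        then obtain a b where ab: "a \<in> f ` A" "dist y a < min r e" "b \<notin> f ` A" "dist y b < min r e"
          using y unfolding frontier_straddle by blast
        obtain x where x: "x \<in> A" "a = f x" using ab(1) by auto
        then have "x = a + v" using e(2)[of x] ab(2) by (simp add: dist_commute algebra_simps)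
        then have "dist (y + v) x = dist y a" by (simp add: dist_norm)
        then show "\<exists>x\<in>A. dist (y + v) x < r" using x(1) ab(2) by (intro bexI[of _ x]) auto
        have "b + v \<notin> A" using pre[of b] ab(3,4) by (metis dist_commute image_eqI min_less_iff_conj)
        then show "\<exists>x. x \<notin> A \<and> dist (y + v) x < r" using ab(4) by (intro exI[of _ "b + v"]) auto
      qed
      then show ?thesis using pre[of y] e(1) by (metis UnI2 dist_self image_eqI)
    qed simp
  qed
  ultimately show ?thesis
    unfolding folding_def using prox_nonexpansive[OF sub] flat_crease[OF fin] fin
    by (intro conjI exI[of _ "crease I"] exI[of _ "(\<lambda>p. - fst p) ` I"]) auto
qed

end

section \<open>Squashing compact sets into hyperplanes\<close>

text \<open>An open neighbourhood of \<open>T\<close> is flattened along with \<open>T\<close>. This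
  tolerates small prior displacements and lets compactness select finitely many stages.\<close>

definition squashable :: "'a::euclidean_space set \<Rightarrow> bool" where
  "squashable T \<longleftrightarrow> (\<forall>\<epsilon>>0. \<exists>f U. folding f \<and> (\<forall>x. norm (f x - x) \<le> \<epsilon>) \<and>
     open U \<and> T \<subseteq> U \<and> flat (f ` U))"

text \<open>If \<open>p\<close> were the only active affine piece at the proximal image of \<open>x\<close>, that image would be
  \<open>x - s *\<^sub>R fst p\<close>; but there \<open>q\<close> has caught up with \<open>p\<close>.\<close>

lemma affine_overtake:
  fixes p q :: "'a::euclidean_space \<times> real"
  assumes "norm (fst p) \<le> L" "norm (fst q) \<le> L" "norm (x - t) \<le> \<delta>" "2 * L * \<delta> \<le> s * \<kappa>" "0 \<le> s"
    and "affine_val p t \<le> affine_val q t" "fst p \<bullet> (fst p - fst q) \<ge> \<kappa>"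
  shows "affine_val p (x - s *\<^sub>R fst p) \<le> affine_val q (x - s *\<^sub>R fst p)"
proof -
  have "\<bar>(fst q - fst p) \<bullet> (x - t)\<bar> \<le> norm (fst q - fst p) * norm (x - t)"
    by (rule Cauchy_Schwarz_ineq2)
  also have "\<dots> \<le> (2 * L) * \<delta>"
    using assms(1-3) norm_triangle_ineq4[of "fst q" "fst p"] norm_ge_zero[of "fst p"]
      norm_ge_zero[of "x - t"]
    by (intro mult_mono) linarith+
  also have "\<dots> \<le> s * (fst p \<bullet> (fst p - fst q))"
    using assms(4,5,7) by (meson mult_left_mono order_trans)
  finally have "- ((fst q - fst p) \<bullet> (x - t)) \<le> s * (fst p \<bullet> (fst p - fst q))" by linarith
  moreover have "affine_val q (x - s *\<^sub>R fst p) - affine_val p (x - s *\<^sub>R fst p) =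
      affine_val q t - affine_val p t + (fst q - fst p) \<bullet> (x - t) + s * (fst p \<bullet> (fst p - fst q))"
    by (simp add: inner_diff_left inner_diff_right inner_commute algebra_simps)
  ultimately show ?thesis using assms(6) by linarith
qed

text \<open>At each point of \<open>T\<close> both families reach the common bound \<open>m\<close>
  with opposed gradients. If one piece of a finite selection were alone active at the proximal image
  of a nearby point, the point would have moved against the gradient of that piece so far that a
  piece of the other family caught up. So the image lies in a crease.\<close>

lemma squashable_if_opposed_envelopes:
  fixes T :: "'a::euclidean_space set"
  assumes "compact T" and "\<kappa> > 0"
    and bound: "\<And>p. p \<in> P \<union> Q \<Longrightarrow> norm (fst p) \<le> L"
    and le: "\<And>p x. p \<in> P \<union> Q \<Longrightarrow> x \<in> T \<Longrightarrow> affine_val p x \<le> m x"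
    and P: "\<And>x. x \<in> T \<Longrightarrow> \<exists>p\<in>P. affine_val p x = m x"
    and Q: "\<And>x. x \<in> T \<Longrightarrow> \<exists>q\<in>Q. affine_val q x = m x"
    and opp: "\<And>p q. p \<in> P \<Longrightarrow> q \<in> Q \<Longrightarrow> fst p \<bullet> (fst p - fst q) \<ge> \<kappa>"
      "\<And>p q. p \<in> P \<Longrightarrow> q \<in> Q \<Longrightarrow> fst q \<bullet> (fst q - fst p) \<ge> \<kappa>"
  shows "squashable T"
  unfolding squashable_def
proof (intro allI impI)
  fix \<epsilon> :: real assume "\<epsilon> > 0"
  show "\<exists>f U. folding f \<and> (\<forall>x. norm (f x - x) \<le> \<epsilon>) \<and> open U \<and> T \<subseteq> U \<and> flat (f ` U)"
  proof (cases "T = {}")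
    case True
    then show ?thesis using \<open>\<epsilon> > 0\<close>
      by (intro exI[of _ id] exI[of _ "{}"]) (simp add: folding_id flat_empty)
  next
    case False
    obtain a where a: "\<And>x. x \<in> T \<Longrightarrow> a x \<in> P \<and> affine_val (a x) x = m x" using P by metis
    obtain b where b: "\<And>x. x \<in> T \<Longrightarrow> b x \<in> Q \<and> affine_val (b x) x = m x" using Q by metis
    define M where "M = max L 1"
    have M: "M > 0" "\<And>p. p \<in> P \<union> Q \<Longrightarrow> norm (fst p) \<le> M"
      using bound unfolding M_def by (auto simp: le_max_iff_disj)
    \<comment> \<open>Scaling the pieces by \<open>s\<close> keeps all gradients, hence the
      displacement, below \<open>\<epsilon>\<close>. The radius \<open>\<delta>\<close> is chosen so
      that the error of at most \<open>2 * M * \<delta>\<close> made by passing from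
      \<open>x\<close> to a net point is absorbed by the gain \<open>s * \<kappa>\<close>.\<close>
    define s where "s = \<epsilon> / M"
    define \<delta> where "\<delta> = s * \<kappa> / (2 * M)"
    have s: "s > 0" and \<delta>: "\<delta> > 0" "2 * M * \<delta> \<le> s * \<kappa>"
      unfolding s_def \<delta>_def using \<open>\<epsilon> > 0\<close> \<open>\<kappa> > 0\<close> M(1) by simp_all
    have "T \<subseteq> (\<Union>x\<in>T. ball x \<delta>)" using \<delta>(1) by auto
    then obtain X where X: "X \<subseteq> T" "finite X" "T \<subseteq> (\<Union>x\<in>X. ball x \<delta>)"
      using compactE_image[OF \<open>compact T\<close>, of T "\<lambda>x. ball x \<delta>"] open_ball by metis
    define J where "J = a ` X \<union> b ` X"
    define I where "I = (*\<^sub>R) s ` J"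
    have "J \<subseteq> P \<union> Q" using X(1) a b unfolding J_def by auto
    have I: "finite I" "I \<noteq> {}" using X False unfolding I_def J_def by auto
    have "\<exists>y. \<forall>z. plin I z \<ge> plin I y + (x - y) \<bullet> (z - y)" for x
      using prox_exists[OF I, of x] by metis
    then obtain f where f: "\<And>x z. plin I z \<ge> plin I (f x) + (x - f x) \<bullet> (z - f x)" by metis
    have "norm (f x - x) \<le> \<epsilon>" for x
    proof (rule prox_displacement[OF I f])
      fix p assume "p \<in> I"
      then obtain r where r: "r \<in> J" "p = s *\<^sub>R r" unfolding I_def by blast
      then have "norm (fst p) = s * norm (fst r)" using s by simp
      also have "\<dots> \<le> s * M" using M(2)[of r] r(1) \<open>J \<subseteq> P \<union> Q\<close> s
        by (intro mult_left_mono) auto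
      finally show "norm (fst p) \<le> \<epsilon>" using M(1) unfolding s_def by simp
    qed
    moreover have "f ` (\<Union>t\<in>X. ball t \<delta>) \<subseteq> crease I"
    proof (rule image_subsetI, rule ccontr)
      fix x assume "x \<in> (\<Union>t\<in>X. ball t \<delta>)" and nc: "f x \<notin> crease I"
      then obtain t where t: "t \<in> X" "norm (x - t) \<le> \<delta>"
        by (auto simp: dist_norm norm_minus_commute less_imp_le)
      then have "t \<in> T" using X(1) by blast
      obtain r where r: "r \<in> I" "x - f x = fst r"
          "\<And>q. q \<in> I \<Longrightarrow> q \<noteq> r \<Longrightarrow> affine_val q (f x) < affine_val r (f x)"
        using subgradient_off_crease[OF I f nc] by metis
      obtain p where p: "p \<in> J" "r = s *\<^sub>R p" using r(1) unfolding I_def by blast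
      have y: "f x = x - s *\<^sub>R fst p" using r(2) p(2) by (simp add: algebra_simps)
      have contra: False if q: "q \<in> J" "m t = affine_val q t" "fst p \<bullet> (fst p - fst q) \<ge> \<kappa>" for q
      proof -
        have "affine_val p (f x) \<le> affine_val q (f x)"
          unfolding y
        proof (rule affine_overtake)
          show "norm (fst p) \<le> M" "norm (fst q) \<le> M"
            using M(2) p(1) q(1) \<open>J \<subseteq> P \<union> Q\<close> by blast+
          show "affine_val p t \<le> affine_val q t"
            unfolding q(2)[symmetric] using le p(1) \<open>J \<subseteq> P \<union> Q\<close> \<open>t \<in> T\<close> by blast
        qed (use t \<delta> s q in auto)
        then have "s * affine_val p (f x) \<le> s * affine_val q (f x)" using s by (intro mult_left_mono) auto
        then have "affine_val r (f x) \<le> affine_val (s *\<^sub>R q) (f x)"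
          unfolding p(2) by (simp add: right_diff_distrib)
        moreover have "s *\<^sub>R q \<in> I" using q(1) unfolding I_def by (rule imageI)
        moreover have "fst p \<noteq> fst q" using q(3) \<open>\<kappa> > 0\<close> by auto
        then have "s *\<^sub>R q \<noteq> r" using s unfolding p(2) by auto
        ultimately show False using r(3)[of "s *\<^sub>R q"] by simp
      qed
      have ab: "a t \<in> J" "b t \<in> J" using t(1) unfolding J_def by auto
      have abt: "a t \<in> P" "b t \<in> Q" "m t = affine_val (a t) t" "m t = affine_val (b t) t"
        using a[OF \<open>t \<in> T\<close>] b[OF \<open>t \<in> T\<close>] by auto
      have "p \<in> P \<or> p \<in> Q" using p(1) \<open>J \<subseteq> P \<union> Q\<close> by blast
      then show False
      proof
        assume "p \<in> P" then show False using contra[OF ab(2) abt(4) opp(1)] abt(2) by blast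
      next
        assume "p \<in> Q" then show False using contra[OF ab(1) abt(3) opp(2)] abt(1) by blast
      qed
    qed
    then have "flat (f ` (\<Union>t\<in>X. ball t \<delta>))" by (rule flat_subset[OF flat_crease[OF I(1)]])
    ultimately show ?thesis
      using prox_folding[OF I f] X(3) by (intro exI[of _ f] exI[of _ "\<Union>t\<in>X. ball t \<delta>"]) auto
  qed
qed

section \<open>Stability of squashability, and countable families of squashable sets\<close>

lemma folding_continuous: "folding f \<Longrightarrow> continuous_on S f"
  using folding_lipschitz lipschitz_on_continuous_on continuous_on_subset by blast

lemma folding_vimage_open: "folding f \<Longrightarrow> open W \<Longrightarrow> open (f -` W)"
  using open_vimage folding_continuous by blast

text \<open>\<open>T\<close> is squashed last: a whole neighbourhood of \<open>T\<close> is squashed, so a sufficiently small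
  displacement caused by squashing \<open>S\<close> beforehand does no harm.\<close>

lemma squashable_Un:
  assumes S: "squashable S" and T: "squashable T" and "compact T"
  shows "squashable (S \<union> T)"
  unfolding squashable_def
proof (intro allI impI)
  fix \<epsilon> :: real assume "\<epsilon> > 0"
  then obtain g W where g: "folding g" "\<And>x. norm (g x - x) \<le> \<epsilon> / 2"
      and W: "open W" "T \<subseteq> W" "flat (g ` W)"
    using T unfolding squashable_def by (meson half_gt_zero)
  obtain \<eta> where \<eta>: "\<eta> > 0" "(\<Union>x\<in>T. cball x \<eta>) \<subseteq> W"
    using compact_subset_open_imp_cball_epsilon_subset[OF \<open>compact T\<close> W(1,2)] by metis
  have "min (\<epsilon> / 2) \<eta> > 0" using \<open>\<epsilon> > 0\<close> \<eta>(1) by simp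
  then obtain f U where f: "folding f" "\<And>x. norm (f x - x) \<le> min (\<epsilon> / 2) \<eta>"
      and U: "open U" "S \<subseteq> U" "flat (f ` U)"
    using S unfolding squashable_def by meson
  have "f x \<in> W" if "x \<in> T" for x
  proof -
    have "dist x (f x) \<le> \<eta>" using f(2)[of x] by (simp add: dist_norm norm_minus_commute)
    then have "f x \<in> cball x \<eta>" by simp
    then show ?thesis using \<eta>(2) that by blast
  qed
  then have "S \<union> T \<subseteq> U \<union> f -` W" using U(2) by auto
  moreover have "open (U \<union> f -` W)" using U(1) W(1) folding_vimage_open[OF f(1)] by blast
  moreover have "norm ((g \<circ> f) x - x) \<le> \<epsilon>" for x
    using g(2)[of "f x"] f(2)[of x] norm_triangle_ineq[of "g (f x) - f x" "f x - x"] by simp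
  moreover have "flat ((g \<circ> f) ` (U \<union> f -` W))"
  proof (rule flat_subset)
    show "flat (g ` f ` U \<union> g ` W)" using U(3) W(3) folding_flat_image[OF g(1)] flat_Un by blast
  qed auto
  ultimately show "\<exists>h V. folding h \<and> (\<forall>x. norm (h x - x) \<le> \<epsilon>) \<and> open V \<and> S \<union> T \<subseteq> V \<and> flat (h ` V)"
    using folding_compose[OF f(1) g(1)] by blast
qed

lemma squashable_empty: "squashable {}"
  unfolding squashable_def
  by (intro allI impI exI[of _ id] exI[of _ "{}"]) (simp add: folding_id flat_empty)

lemma squashable_Union:
  assumes "finite F" "\<And>T. T \<in> F \<Longrightarrow> compact T \<and> squashable T"
  shows "squashable (\<Union>F)"
  using assms
proof (induction F)
  case (insert T F)
  then have "squashable (\<Union>F \<union> T)" by (intro squashable_Un) auto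
  then show ?case by (simp add: Un_commute)
qed (simp add: squashable_empty)

lemma folding_translation: "folding ((+) d)"
proof -
  have "1-lipschitz_on UNIV ((+) d)" by (intro lipschitz_onI) (auto simp: dist_norm)
  moreover have "surj ((+) d)" by (rule surjI[of _ "\<lambda>x. x - d"]) simp
  ultimately show ?thesis unfolding folding_def
    by (intro conjI exI[of _ "{}"] exI[of _ "{d}"]) (auto simp: flat_empty frontier_translation)
qed

lemma squashable_translation:
  assumes "squashable T" shows "squashable ((+) d ` T)"
  unfolding squashable_def
proof (intro allI impI)
  fix \<epsilon> :: real assume "\<epsilon> > 0"
  then obtain f U where f: "folding f" "\<And>x. norm (f x - x) \<le> \<epsilon>"
      and U: "open U" "T \<subseteq> U" "flat (f ` U)"
    using assms unfolding squashable_def by meson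
  let ?g = "(+) d \<circ> (f \<circ> (+) (- d))"
  have "folding ?g" by (intro folding_compose folding_translation f(1))
  moreover have "norm (?g x - x) \<le> \<epsilon>" for x using f(2)[of "x - d"] by (simp add: algebra_simps)
  moreover have "open ((+) d ` U)" using U(1) by (rule open_translation)
  moreover have "(+) d ` T \<subseteq> (+) d ` U" using U(2) by (rule image_mono)
  moreover have "?g ` (+) d ` U = (+) d ` f ` U" by (simp add: image_comp comp_def)
  then have "flat (?g ` (+) d ` U)" using flat_translation[OF U(3)] by metis
  ultimately show "\<exists>f V. folding f \<and> (\<forall>x. norm (f x - x) \<le> \<epsilon>) \<and> open V \<and> (+) d ` T \<subseteq> V \<and> flat (f ` V)"
    by blast
qed

text \<open>On the hyperplane \<open>a \<bullet> x = c\<close> the affine functions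
  \<open>a \<bullet> x - c\<close> and \<open>c - a \<bullet> x\<close> both vanish and have
  opposite gradients, so each one is an envelope by itself.\<close>

lemma squashable_flat:
  assumes "compact T" "flat T" shows "squashable T"
proof -
  obtain \<H> where H: "finite \<H>" "\<forall>H\<in>\<H>. affine_hyperplane H" "T \<subseteq> \<Union>\<H>"
    using assms unfolding flat_def by blast
  have "compact (T \<inter> H) \<and> squashable (T \<inter> H)" if "H \<in> \<H>" for H
  proof -
    have "\<exists>a c. a \<noteq> 0 \<and> H = {x. a \<bullet> x = c}"
      using H(2)[rule_format, OF that] unfolding affine_hyperplane_def .
    then obtain a c where ac: "a \<noteq> 0" "H = {x. a \<bullet> x = c}" by (elim exE conjE)
    have comp: "compact (T \<inter> H)"
      using assms(1) closed_hyperplane[of a c] unfolding ac(2) by (rule compact_Int_closed)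
    have "squashable (T \<inter> H)"
    proof (rule squashable_if_opposed_envelopes[OF comp, of "2 * (a \<bullet> a)" "{(a, c)}" "{(- a, - c)}" "norm a" "\<lambda>x. 0"])
      show "2 * (a \<bullet> a) > 0" using ac(1) by simp
    qed (auto simp: ac(2) inner_add_right inner_diff_right)
    then show ?thesis using comp by blast
  qed
  then have "squashable (\<Union>((\<inter>) T ` \<H>))" using H(1) by (intro squashable_Union) auto
  moreover have "T = \<Union>((\<inter>) T ` \<H>)" using H(3) by (simp add: Int_absorb2)
  ultimately show ?thesis by simp
qed

text \<open>The image of \<open>T\<close> under \<open>F\<close> is covered by finitely many
  translates of \<open>T\<close> and a compact flat remainder, all of them squashable. The set
  \<open>U\<close> is the preimage under \<open>F\<close> of the neighbourhood flattened by
  \<open>g\<close>.\<close>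

lemma squash_after_folding:
  assumes F: "folding F" and T: "compact T" "squashable T" and "\<epsilon> > 0"
  obtains g U where "folding g" "\<And>x. norm (g x - x) \<le> \<epsilon>" "open U" "T \<subseteq> U" "flat ((g \<circ> F) ` U)"
proof -
  obtain Z D where ZD: "flat Z" "finite D" "\<And>x. F x \<in> Z \<or> F x - x \<in> D"
    using F unfolding folding_def by metis
  obtain \<H> where H: "finite \<H>" "\<forall>H\<in>\<H>. affine_hyperplane H" "Z \<subseteq> \<Union>\<H>"
    using ZD(1) unfolding flat_def by blast
  \<comment> \<open>\<open>Z\<close> is replaced by a closed union of hyperplanes, so that the
    remainder is compact.\<close>
  have "closed H" if "H \<in> \<H>" for H
    using H(2) that unfolding affine_hyperplane_def by (metis closed_hyperplane)
  then have "closed (\<Union>\<H>)" using H(1) by (intro closed_Union) auto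
  moreover have "compact (F ` T)" using folding_continuous[OF F] T(1) by (rule compact_continuous_image)
  ultimately have c1: "compact (F ` T \<inter> \<Union>\<H>)" by (intro compact_Int_closed)
  have "flat (F ` T \<inter> \<Union>\<H>)" unfolding flat_def using H(1,2) by (intro exI[of _ \<H>]) simp
  then have s1: "squashable (F ` T \<inter> \<Union>\<H>)" using c1 by (intro squashable_flat)
  let ?E = "\<Union>d\<in>D. (+) d ` T"
  have s2: "squashable ?E"
    using ZD(2) T by (intro squashable_Union) (auto intro: compact_translation squashable_translation)
  have "squashable (?E \<union> (F ` T \<inter> \<Union>\<H>))" by (rule squashable_Un[OF s2 s1 c1])
  then obtain g W where g: "folding g" "\<And>x. norm (g x - x) \<le> \<epsilon>"
      and W: "open W" "?E \<union> (F ` T \<inter> \<Union>\<H>) \<subseteq> W" "flat (g ` W)"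
    using \<open>\<epsilon> > 0\<close> unfolding squashable_def by meson
  have "T \<subseteq> F -` W"
  proof
    fix x assume "x \<in> T"
    consider "F x \<in> Z" | "F x - x \<in> D" using ZD(3) by blast
    then have "F x \<in> ?E \<union> (F ` T \<inter> \<Union>\<H>)"
    proof cases
      case 1 then show ?thesis using H(3) \<open>x \<in> T\<close> by auto
    next
      case 2
      have "F x \<in> (+) (F x - x) ` T" using \<open>x \<in> T\<close> by (intro image_eqI[of _ _ x]) auto
      then show ?thesis using 2 by blast
    qed
    then show "x \<in> F -` W" using W(2) by blast
  qed
  moreover have "flat ((g \<circ> F) ` (F -` W))" by (rule flat_subset[OF W(3)]) auto
  ultimately show ?thesis using that[OF g] folding_vimage_open[OF F W(1)] by blast
qed

text \<open>Stage \<open>n\<close> flattens a neighbourhood of \<open>T n\<close> with additional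
  displacement at most \<open>\<epsilon> / 2 ^ Suc n\<close>, and later foldings keep flat images
  flat. Finitely many of the neighbourhoods cover \<open>K\<close>, so a finite stage flattens all
  of \<open>K\<close>.\<close>

lemma countable_squash:
  fixes T :: "nat \<Rightarrow> 'a::euclidean_space set"
  assumes T: "\<And>n. compact (T n)" "\<And>n. squashable (T n)"
    and K: "compact K" "K \<subseteq> (\<Union>n. T n)" and "\<epsilon> > 0"
  obtains f where "folding f" "\<And>x. norm (f x - x) \<le> \<epsilon>" "flat (f ` K)"
proof -
  let ?P = "\<lambda>n F. folding F \<and> (\<forall>x. norm (F x - x) \<le> \<epsilon> * (1 - 1 / 2 ^ n))"
  let ?Q = "\<lambda>n F F'. \<exists>g U. folding g \<and> F' = g \<circ> F \<and> open U \<and> T n \<subseteq> U \<and> flat (F' ` U)"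
  have "\<exists>F. \<forall>n. ?P n (F n) \<and> ?Q n (F n) (F (Suc n))"
  proof (rule dependent_nat_choice)
    show "\<exists>F. ?P 0 F" by (intro exI[of _ id]) (simp add: folding_id)
    fix F :: "'a \<Rightarrow> 'a" and n assume F: "?P n F"
    have "\<epsilon> / 2 ^ Suc n > 0" using \<open>\<epsilon> > 0\<close> by simp
    then obtain g U where g: "folding g" "\<And>x. norm (g x - x) \<le> \<epsilon> / 2 ^ Suc n"
        and U: "open U" "T n \<subseteq> U" "flat ((g \<circ> F) ` U)"
      using squash_after_folding F T by metis
    have "norm ((g \<circ> F) x - x) \<le> \<epsilon> * (1 - 1 / 2 ^ Suc n)" for x
    proof -
      have "norm ((g \<circ> F) x - x) \<le> norm (g (F x) - F x) + norm (F x - x)"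
        using norm_triangle_ineq[of "g (F x) - F x" "F x - x"] by simp
      also have "\<dots> \<le> \<epsilon> / 2 ^ Suc n + \<epsilon> * (1 - 1 / 2 ^ n)" using g(2) F by (intro add_mono) auto
      also have "\<dots> = \<epsilon> * (1 - 1 / 2 ^ Suc n)" by (simp add: field_simps)
      finally show ?thesis .
    qed
    then show "\<exists>F'. ?P (Suc n) F' \<and> ?Q n F F'"
      using folding_compose[of F g] F g(1) U by (intro exI[of _ "g \<circ> F"]) blast
  qed
  then obtain F where F: "\<And>n. ?P n (F n)" "\<And>n. ?Q n (F n) (F (Suc n))" by metis
  obtain g U where gU: "\<And>n. folding (g n) \<and> F (Suc n) = g n \<circ> F n \<and> open (U n) \<and> T n \<subseteq> U n \<and> flat (F (Suc n) ` U n)"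
    using F(2) by metis
  have keep: "flat (F m ` U n)" if "Suc n \<le> m" for m n
    using that
  proof (induction m rule: dec_induct)
    case base then show ?case using gU by blast
  next
    case (step m)
    have "F (Suc m) ` U n = g m ` F m ` U n" using gU[of m] by (simp add: image_comp)
    then show ?case using folding_flat_image gU step.IH by metis
  qed
  have "K \<subseteq> (\<Union>n\<in>UNIV. U n)" using K(2) gU by blast
  then obtain N where N: "finite N" "K \<subseteq> (\<Union>n\<in>N. U n)"
    using compactE_image[OF K(1), of UNIV U] gU by metis
  then obtain m where m: "\<And>n. n \<in> N \<Longrightarrow> n < m" using finite_nat_set_iff_bounded by metis
  have "F m ` K \<subseteq> (\<Union>n\<in>N. F m ` U n)" using N(2) by blast
  moreover have "flat (\<Union>n\<in>N. F m ` U n)" using N(1) keep m by (intro flat_Union) (auto simp: Suc_le_eq)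
  ultimately have "flat (F m ` K)" by (rule flat_subset[rotated])
  moreover have "norm (F m x - x) \<le> \<epsilon>" for x
  proof -
    have "\<epsilon> * (1 - 1 / 2 ^ m) \<le> \<epsilon> * 1" using \<open>\<epsilon> > 0\<close> by (intro mult_left_mono) auto
    then show ?thesis using F(1)[of m] by (smt (verit, best))
  qed
  ultimately show ?thesis using that F(1) by blast
qed

section \<open>From squashable covers of the frontier to the Kolmogorov properties\<close>

text \<open>As \<open>r\<close> decreases to 0 these sets increase to the interior of
  \<open>A\<close>, which has the measure of \<open>A\<close> because the frontier is
  negligible.\<close>

lemma measure_inner_parts:
  fixes A :: "'a::euclidean_space set"
  assumes "bounded A" "negligible (frontier A)" "\<epsilon> > 0"
  obtains r where "r > 0" "{y. ball y r \<subseteq> A} \<in> lmeasurable"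
    "measure lebesgue {y. ball y r \<subseteq> A} > measure lebesgue A - \<epsilon>"
proof -
  define E where "E r = {y. ball y r \<subseteq> A}" for r
  have closed: "closed (E r)" for r
  proof -
    have "- E r = (\<Union>z\<in>- A. ball z r)" unfolding E_def by (auto simp: dist_commute)
    moreover have "open (\<Union>z\<in>- A. ball z r)" by (intro open_UN) simp
    ultimately show ?thesis by (simp only: closed_def)
  qed
  have sub: "E r \<subseteq> A" if "r > 0" for r unfolding E_def using that by (auto simp: subset_iff)
  have meas: "E r \<in> lmeasurable" if "r > 0" for r
    using closed bounded_subset[OF assms(1) sub[OF that]] lmeasurable_compact compact_eq_bounded_closed by blast
  let ?r = "\<lambda>n. inverse (real (Suc n))"
  have "incseq (\<lambda>n. E (?r n))"
  proof (rule incseq_SucI)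
    fix n
    have "ball y (?r (Suc n)) \<subseteq> ball y (?r n)" for y :: 'a by (intro subset_ball) (simp add: field_simps)
    then show "E (?r n) \<subseteq> E (?r (Suc n))" unfolding E_def by blast
  qed
  moreover have UN: "(\<Union>n. E (?r n)) = interior A"
  proof (intro equalityI subsetI)
    fix y assume "y \<in> interior A"
    then obtain e where e: "e > 0" "ball y e \<subseteq> A" unfolding mem_interior by blast
    then obtain n where "?r n < e" using reals_Archimedean by blast
    then have "ball y (?r n) \<subseteq> A" using e(2) subset_ball[of "?r n" e y] by (meson less_imp_le order_trans)
    then show "y \<in> (\<Union>n. E (?r n))" unfolding E_def by blast
  next
    fix y assume "y \<in> (\<Union>n. E (?r n))"
    then obtain n where "ball y (?r n) \<subseteq> A" unfolding E_def by blast
    then show "y \<in> interior A" unfolding mem_interior by (intro exI[of _ "?r n"]) simp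
  qed
  moreover have int: "interior A \<in> lmeasurable"
    using bounded_subset[OF assms(1) interior_subset] by (intro lmeasurable_open) auto
  moreover have "emeasure lebesgue (interior A) \<noteq> \<infinity>" using int by (auto simp: fmeasurable_def)
  moreover have "range (\<lambda>n. E (?r n)) \<subseteq> sets lebesgue" using meas by (auto simp: fmeasurableD)
  ultimately have "(\<lambda>n. measure lebesgue (E (?r n))) \<longlonglongrightarrow> measure lebesgue (interior A)"
    using Lim_measure_incseq[of "\<lambda>n. E (?r n)" lebesgue] by simp
  moreover have "measure lebesgue (interior A) = measure lebesgue A"
    by (rule measure_interior[OF assms(1,2)])
  ultimately have "eventually (\<lambda>n. measure lebesgue (E (?r n)) > measure lebesgue A - \<epsilon>) sequentially"
    using \<open>\<epsilon> > 0\<close> by (intro order_tendstoD(1)) auto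
  then obtain n where "measure lebesgue (E (?r n)) > measure lebesgue A - \<epsilon>"
    unfolding eventually_sequentially by blast
  then show ?thesis using that[of "?r n"] meas[of "?r n"] unfolding E_def by simp
qed

lemma Kolmogorov_if_squashable_cover:
  fixes A :: "'a::euclidean_space set"
  assumes "bounded A" and "countable \<T>"
    and T: "\<And>T. T \<in> \<T> \<Longrightarrow> compact T \<and> squashable T \<and> negligible T"
    and "frontier A \<subseteq> \<Union>\<T>"
  shows "distance_Kolmogorov A \<and> measure_Kolmogorov A"
proof -
  have neg: "negligible (frontier A)"
    using assms negligible_countable_Union negligible_subset by metis
  \<comment> \<open>Inserting the empty set makes the family nonempty, so that it can be
    enumerated.\<close>
  define T where "T = from_nat_into (insert {} \<T>)"
  have Tn: "range T = insert {} \<T>"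
    unfolding T_def using \<open>countable \<T>\<close> by (intro range_from_nat_into) simp_all
  have "compact (T n) \<and> squashable (T n)" for n
  proof -
    have "T n \<in> insert {} \<T>" using Tn by blast
    then show ?thesis using T squashable_empty by auto
  qed
  moreover have "compact (frontier A)" using \<open>bounded A\<close> by (rule compact_frontier_bounded)
  moreover have "frontier A \<subseteq> (\<Union>n. T n)" unfolding Tn using assms(4) by simp
  ultimately have ex: "\<exists>f. folding f \<and> (\<forall>x. norm (f x - x) \<le> \<epsilon>) \<and> flat (f ` frontier A)" if "\<epsilon> > 0" for \<epsilon>
    using countable_squash[of T "frontier A" \<epsilon>] that by metis
  \<comment> \<open>The frontier of the image lies in \<open>Z\<close> and the image of the frontier
    of \<open>A\<close>, both flat. It is therefore negligible, which makes the bounded image Jordan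
    measurable.\<close>
  have good: "1-lipschitz_on A f \<and> polyhedral_boundary (f ` A) \<and> f ` A \<in> lmeasurable"
    if f: "folding f" "flat (f ` frontier A)" for f
  proof -
    obtain Z where Z: "flat Z" "frontier (f ` A) \<subseteq> Z \<union> f ` frontier A"
      using f(1) unfolding folding_def by metis
    then have fl: "flat (frontier (f ` A))" using f(2) flat_Un flat_subset by metis
    have "bounded (f ` closure A)"
      using \<open>bounded A\<close> folding_continuous[OF f(1)]
      by (intro compact_imp_bounded compact_continuous_image) auto
    then have "bounded (f ` A)" by (rule bounded_subset) (use closure_subset in blast)
    then have "f ` A \<in> lmeasurable" using negligible_flat[OF fl] by (intro measurable_Jordan)
    moreover have "1-lipschitz_on A f" using folding_lipschitz[OF f(1)] by (rule lipschitz_on_subset) simp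
    ultimately show ?thesis using fl unfolding flat_def polyhedral_boundary_def by simp
  qed
  have "distance_Kolmogorov A"
    unfolding distance_Kolmogorov_def
  proof (intro conjI allI impI)
    fix \<epsilon> :: real assume "\<epsilon> > 0"
    then obtain f where "folding f" "\<forall>x. norm (f x - x) \<le> \<epsilon>" "flat (f ` frontier A)" using ex by blast
    then show "\<exists>f. 1-lipschitz_on A f \<and> polyhedral_boundary (f ` A) \<and> (\<forall>x\<in>A. norm (f x - x) \<le> \<epsilon>)"
      using good by blast
  qed (rule \<open>bounded A\<close>)
  moreover have "measure_Kolmogorov A"
    unfolding measure_Kolmogorov_def
  proof (intro conjI allI impI)
    show "A \<in> sets lebesgue" using measurable_Jordan[OF \<open>bounded A\<close> neg] by (rule fmeasurableD)
    fix \<epsilon> :: real assume "\<epsilon> > 0"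
    then obtain r where r: "r > 0" "{y. ball y r \<subseteq> A} \<in> lmeasurable"
        "measure lebesgue {y. ball y r \<subseteq> A} > measure lebesgue A - \<epsilon>"
      using measure_inner_parts[OF \<open>bounded A\<close> neg] by metis
    then obtain f where f: "folding f" "\<And>x. norm (f x - x) \<le> r / 2" "flat (f ` frontier A)"
      using ex[of "r / 2"] by auto
    have "{y. ball y r \<subseteq> A} \<subseteq> f ` A"
    proof
      fix y assume y: "y \<in> {y. ball y r \<subseteq> A}"
      \<comment> \<open>Every preimage of \<open>y\<close> is within \<open>r / 2\<close> of it,
        hence in the ball about \<open>y\<close> that is contained in \<open>A\<close>.\<close>
      obtain x where x: "y = f x" using folding_surj[OF f(1)] by (metis surjD)
      then have "x \<in> ball y r" using f(2)[of x] r(1) by (simp add: dist_norm)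
      then show "y \<in> f ` A" using x y by blast
    qed
    then have "measure lebesgue {y. ball y r \<subseteq> A} \<le> measure lebesgue (f ` A)"
      using good[OF f(1,3)] r(2) by (intro measure_mono_fmeasurable) (auto simp: fmeasurableD)
    then show "\<exists>f :: 'a \<Rightarrow> 'a. 1-lipschitz_on A f \<and> polyhedral_boundary (f ` A) \<and>
        measure lebesgue (f ` A) > measure lebesgue A - \<epsilon>"
      using good[OF f(1,3)] r(3) by (meson less_le_trans)
  qed (rule \<open>bounded A\<close>)
  ultimately show ?thesis by blast
qed

section \<open>Pieces of convex and of regular hypersurfaces\<close>

text \<open>Lindelof's theorem is applied in the parameter space, so \<open>F\<close> may be a
  parametrisation as well as the identity.\<close>

lemma countable_cover_from_local:
  fixes U :: "'a::second_countable_topology set"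
  assumes local: "\<And>u. u \<in> U \<Longrightarrow> \<exists>W T. open W \<and> u \<in> W \<and> G T \<and> F ` (U \<inter> W) \<subseteq> T"
  obtains \<T> where "countable \<T>" "\<And>T. T \<in> \<T> \<Longrightarrow> G T" "F ` U \<subseteq> \<Union>\<T>"
proof -
  obtain W T where WT: "\<And>u. u \<in> U \<Longrightarrow> open (W u) \<and> u \<in> W u \<and> G (T u) \<and> F ` (U \<inter> W u) \<subseteq> T u"
    using local by metis
  obtain \<W> where \<W>: "\<W> \<subseteq> W ` U" "countable \<W>" "\<Union>\<W> = \<Union>(W ` U)"
    using Lindelof[of "W ` U"] WT by (metis imageE)
  then obtain C where C: "countable C" "C \<subseteq> U" "\<W> = W ` C"
    by (meson countable_subset_image)
  have "F u \<in> \<Union>(T ` C)" if "u \<in> U" for u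
  proof -
    have "u \<in> \<Union>(W ` C)" using \<W>(3) C(3) WT that by blast
    then obtain c where c: "c \<in> C" "u \<in> W c" by blast
    then have "F u \<in> T c" using WT[of c] C(2) that by blast
    then show ?thesis using c(1) by blast
  qed
  then show ?thesis using that[of "T ` C"] C(1,2) WT by blast
qed

section \<open>Convex hypersurfaces\<close>

definition good_piece :: "'a::euclidean_space set \<Rightarrow> bool" where
  "good_piece T \<longleftrightarrow> compact T \<and> squashable T \<and> negligible T"

text \<open>Supporting half-spaces supply one envelope and a single affine function the other. They
  are uniformly opposed because on a small piece all outer normals have a positive component,
  bounded away from 0, along \<open>s0 - c\<close>.\<close>

lemma good_piece_convex_frontier:
  fixes C :: "'a::euclidean_space set"
  assumes "convex C" and c: "cball c \<rho> \<subseteq> C" "\<rho> > 0" and s0: "s0 \<in> frontier C"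
  shows "good_piece (frontier C \<inter> cball s0 (\<rho> / 2))"
proof -
  let ?T = "frontier C \<inter> cball s0 (\<rho> / 2)"
  have comp: "compact ?T" by (simp add: closed_Int_compact)
  have "\<exists>n. norm n = 1 \<and> (\<forall>y\<in>closure C. n \<bullet> y \<le> n \<bullet> s)" if "s \<in> frontier C" for s
  proof -
    have "interior C \<noteq> {}" using c by (metis ball_subset_cball centre_in_ball empty_iff mem_interior order_trans)
    then have "s \<in> closure C" "s \<notin> rel_interior C"
      using that rel_interior_nonempty_interior unfolding frontier_def by auto
    then obtain a where a: "a \<noteq> 0" "\<And>y. y \<in> closure C \<Longrightarrow> a \<bullet> s \<le> a \<bullet> y"
      using supporting_hyperplane_relative_frontier[OF \<open>convex C\<close>] by metis
    have "- sgn a \<bullet> y \<le> - sgn a \<bullet> s" if "y \<in> closure C" for y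
      using a(2)[OF that] unfolding sgn_div_norm by (simp add: mult_left_mono)
    moreover have "norm (- sgn a) = 1" using a(1) by (simp add: norm_sgn)
    ultimately show ?thesis by blast
  qed
  then obtain n where n: "\<And>s. s \<in> frontier C \<Longrightarrow> norm (n s) = 1"
      "\<And>s y. s \<in> frontier C \<Longrightarrow> y \<in> closure C \<Longrightarrow> n s \<bullet> y \<le> n s \<bullet> s" by metis
  \<comment> \<open>The ball about \<open>c\<close> lies in the supporting half-space at
    \<open>s\<close>, so the component of \<open>s - c\<close> along \<open>n s\<close> is at least
    \<open>\<rho>\<close>. Replacing \<open>s\<close> by \<open>s0\<close> costs at most
    \<open>\<rho> / 2\<close>.\<close>
  have far: "n s \<bullet> (s0 - c) \<ge> \<rho> / 2" if "s \<in> ?T" for s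
  proof -
    have s: "s \<in> frontier C" "dist s0 s \<le> \<rho> / 2" using that by auto
    have "c + \<rho> *\<^sub>R n s \<in> cball c \<rho>" using n(1)[OF s(1)] c(2) by (simp add: dist_norm)
    then have "c + \<rho> *\<^sub>R n s \<in> closure C" using c(1) closure_subset by blast
    then have "n s \<bullet> (c + \<rho> *\<^sub>R n s) \<le> n s \<bullet> s" using n(2)[OF s(1)] by blast
    moreover have "n s \<bullet> n s = 1" using n(1)[OF s(1)] by (simp add: norm_eq_1)
    ultimately have "\<rho> \<le> n s \<bullet> (s - c)" by (simp add: inner_add_right inner_diff_right)
    moreover have "n s \<bullet> (s - s0) \<le> norm (n s) * norm (s - s0)" by (rule norm_cauchy_schwarz)
    then have "n s \<bullet> (s - s0) \<le> \<rho> / 2" using n(1)[OF s(1)] s(2) by (simp add: dist_norm norm_minus_commute)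
    ultimately show ?thesis by (simp add: inner_diff_right)
  qed
  define R where "R = norm (s0 - c)"
  have "s0 \<in> ?T" using s0 c(2) by simp
  then have "n s0 \<bullet> (s0 - c) > 0" using far[of s0] c(2) by simp
  then have "R > 0" unfolding R_def by auto
  \<comment> \<open>The envelopes are \<open>sup (n s \<bullet> (x - s))\<close> and \<open>0\<close>; subtracting the linear function \<open>a\<close> from both
    makes the second gradient point inwards instead of vanishing.\<close>
  define a where "a = (1 / (2 * R)) *\<^sub>R (s0 - c)"
  have na: "norm a = 1 / 2" unfolding a_def using \<open>R > 0\<close> by (simp add: R_def)
  have a_ge: "n s \<bullet> a \<ge> \<rho> / (4 * R)" if "s \<in> ?T" for s
  proof -
    have "\<rho> / (4 * R) = (\<rho> / 2) / (2 * R)" by simp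
    also have "\<dots> \<le> (n s \<bullet> (s0 - c)) / (2 * R)"
      using far[OF that] \<open>R > 0\<close> by (intro divide_right_mono) auto
    finally show ?thesis unfolding a_def by simp
  qed
  have a_le: "n s \<bullet> a \<le> 1 / 2" if "s \<in> ?T" for s
    using norm_cauchy_schwarz[of "n s" a] n(1)[of s] that na by simp
  have "squashable ?T"
  \<comment> \<open>Here \<open>fst p - fst q\<close> is \<open>n s\<close>, so the two products are
    \<open>1 - a \<bullet> n s\<close> and \<open>a \<bullet> n s\<close>; \<open>a_le\<close> and
    \<open>a_ge\<close> bound them below.\<close>
  proof (rule squashable_if_opposed_envelopes[OF comp, of "min (1 / 2) (\<rho> / (4 * R))"
        "(\<lambda>s. (n s - a, n s \<bullet> s)) ` ?T" "{(- a, 0)}" 2 "\<lambda>x. - (a \<bullet> x)"])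
    show "0 < min (1 / 2) (\<rho> / (4 * R))" using c(2) \<open>R > 0\<close> by simp
    fix p assume "p \<in> (\<lambda>s. (n s - a, n s \<bullet> s)) ` ?T \<union> {(- a, 0)}"
    then consider "p = (- a, 0)" | s where "s \<in> ?T" "p = (n s - a, n s \<bullet> s)" by blast
    note p_cases = this
    show "norm (fst p) \<le> 2" using p_cases
    proof cases
      case (2 s)
      then show ?thesis using norm_triangle_ineq4[of "n s" a] n(1)[of s] na by simp
    qed (simp add: na)
    fix x assume "x \<in> ?T"
    then have "x \<in> closure C" by (simp add: frontier_def)
    show "affine_val p x \<le> - (a \<bullet> x)" using p_cases
    proof cases
      case (2 s)
      then show ?thesis using n(2)[of s x] \<open>x \<in> closure C\<close> by (simp add: inner_diff_left)
    qed simp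
  next
    fix x assume "x \<in> ?T"
    then show "\<exists>p\<in>(\<lambda>s. (n s - a, n s \<bullet> s)) ` ?T. affine_val p x = - (a \<bullet> x)"
      by (intro bexI[of _ "(n x - a, n x \<bullet> x)"]) (simp_all add: inner_diff_left)
    show "\<exists>q\<in>{(- a, 0)}. affine_val q x = - (a \<bullet> x)" by simp
  next
    fix p q :: "'a \<times> real"
    assume "p \<in> (\<lambda>s. (n s - a, n s \<bullet> s)) ` ?T" and q: "q \<in> {(- a, 0)}"
    then obtain s where s: "s \<in> ?T" "p = (n s - a, n s \<bullet> s)" by blast
    have "n s \<bullet> n s = 1" using n(1)[of s] s(1) by (simp add: norm_eq_1)
    then show "fst p \<bullet> (fst p - fst q) \<ge> min (1 / 2) (\<rho> / (4 * R))"
      using a_le[OF s(1)] s(2) q by (simp add: inner_diff_right inner_commute)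
    show "fst q \<bullet> (fst q - fst p) \<ge> min (1 / 2) (\<rho> / (4 * R))"
      using a_ge[OF s(1)] s(2) q by (simp add: inner_commute)
  qed
  moreover have "negligible ?T"
    using negligible_convex_frontier[OF \<open>convex C\<close>] by (rule negligible_subset) blast
  ultimately show ?thesis using comp unfolding good_piece_def by blast
qed

text \<open>A convex set with empty interior lies in a hyperplane, and so does its frontier.
  Otherwise a ball inside the set fixes one radius that serves at every frontier point.\<close>

lemma convex_hypersurface_cover:
  fixes S :: "'a::euclidean_space set"
  assumes "convex_hypersurface S"
  obtains \<T> where "countable \<T>" "\<And>T. T \<in> \<T> \<Longrightarrow> good_piece T" "S \<subseteq> \<Union>\<T>"
proof -
  obtain C where C: "convex C" "S \<subseteq> frontier C" using assms unfolding convex_hypersurface_def by blast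
  have "\<exists>W T. open W \<and> x \<in> W \<and> good_piece T \<and> id ` (frontier C \<inter> W) \<subseteq> T" if x: "x \<in> frontier C" for x
  proof (cases "interior C = {}")
    case True
    obtain a b where ab: "a \<noteq> 0" "C \<subseteq> {x. a \<bullet> x = b}"
      using empty_interior_subset_hyperplane[OF C(1) True] by metis
    have "closure C \<subseteq> {x. a \<bullet> x = b}" using ab(2) closed_hyperplane by (rule closure_minimal)
    then have sub: "frontier C \<subseteq> {x. a \<bullet> x = b}" by (auto simp: frontier_def)
    have fl: "flat ({x. a \<bullet> x = b} \<inter> cball x 1)"
      using flat_hyperplane[OF ab(1), of b] by (rule flat_subset) simp
    moreover have comp: "compact ({x. a \<bullet> x = b} \<inter> cball x 1)"
      by (simp add: closed_Int_compact closed_hyperplane)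
    ultimately have "good_piece ({x. a \<bullet> x = b} \<inter> cball x 1)"
      unfolding good_piece_def using squashable_flat negligible_flat by blast
    moreover have "id ` (frontier C \<inter> ball x 1) \<subseteq> {x. a \<bullet> x = b} \<inter> cball x 1"
      using sub ball_subset_cball[of x 1] by auto
    ultimately show ?thesis
      by (intro exI[of _ "ball x 1"] exI[of _ "{x. a \<bullet> x = b} \<inter> cball x 1"]) simp
  next
    case False
    then obtain c \<rho> where c: "\<rho> > 0" "cball c \<rho> \<subseteq> C" unfolding mem_interior_cball[symmetric] by (metis ex_in_conv mem_interior_cball)
    have "id ` (frontier C \<inter> ball x (\<rho> / 2)) \<subseteq> frontier C \<inter> cball x (\<rho> / 2)"
      using ball_subset_cball[of x "\<rho> / 2"] by auto
    then show ?thesis using good_piece_convex_frontier[OF C(1) c(2,1) x] c(1)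
      by (intro exI[of _ "ball x (\<rho> / 2)"] exI[of _ "frontier C \<inter> cball x (\<rho> / 2)"]) simp
  qed
  then obtain \<T> where "countable \<T>" "\<And>T. T \<in> \<T> \<Longrightarrow> good_piece T" "id ` frontier C \<subseteq> \<Union>\<T>"
    using countable_cover_from_local[of "frontier C" good_piece id] by metis
  then show ?thesis using that[of \<T>] C(2) by simp
qed

section \<open>Regular C^2 hypersurfaces and balls touching them from both sides\<close>

lemma opposed_if_near_axis:
  fixes n0 :: "'a::real_inner"
  assumes "norm n0 = 1" "norm (v - n0) \<le> 1/4" "norm (w + n0) \<le> 1/4"
  shows "v \<bullet> (v - w) \<ge> 1/2"
proof -
  have n: "n0 \<bullet> n0 = 1" using assms(1) by (simp add: norm_eq_1)
  have v: "norm v \<le> 5/4" using norm_triangle_ineq[of "v - n0" n0] assms(1,2) by simp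
  have "\<bar>(v - n0) \<bullet> n0\<bar> \<le> 1/4" using Cauchy_Schwarz_ineq2[of "v - n0" n0] assms(1,2) by simp
  then have "\<bar>v \<bullet> n0 - 1\<bar> \<le> 1/4" using n by (simp add: inner_diff_left)
  then have "v \<bullet> n0 \<ge> 3/4" by linarith
  moreover have "norm ((v - n0) - (w + n0)) \<le> 1/2"
    using norm_triangle_ineq4[of "v - n0" "w + n0"] assms(2,3) by simp
  then have "norm v * norm ((v - n0) - (w + n0)) \<le> 5/4 * (1/2)" using v by (intro mult_mono) auto
  then have "\<bar>v \<bullet> ((v - n0) - (w + n0))\<bar> \<le> 5/8"
    using Cauchy_Schwarz_ineq2[of v "(v - n0) - (w + n0)"] by linarith
  then have "\<bar>v \<bullet> (v - w) - 2 * (v \<bullet> n0)\<bar> \<le> 5/8"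
    by (simp add: inner_diff_right inner_add_right algebra_simps)
  ultimately show ?thesis by linarith
qed

text \<open>The hypothesis \<open>tangent\<close> says that \<open>F ` N\<close> stays outside the two balls of radius \<open>norm (n x) / M\<close> touching
  it at \<open>F x\<close>. It makes both suprema over \<open>x\<close> of
  \<open>\<plusminus> n x \<bullet> (z - F x) + M / 2 * |z - p|\<^sup>2 - M / 2 * |z - F x|\<^sup>2\<close>, which are affine in \<open>z\<close>, equal to
  \<open>M / 2 * |z - p|\<^sup>2\<close> on \<open>F ` N\<close>.\<close>

lemma squashable_if_tangent_balls:
  fixes F n :: "'b \<Rightarrow> 'a::euclidean_space"
  assumes comp: "compact (F ` N)" and "norm n0 = 1"
    and tangent: "\<And>x y. x \<in> N \<Longrightarrow> y \<in> N \<Longrightarrow> \<bar>n x \<bullet> (F y - F x)\<bar> \<le> M / 2 * (norm (F y - F x))\<^sup>2"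
    and near: "\<And>x. x \<in> N \<Longrightarrow> norm (n x - n0) \<le> 1/8" "\<And>x. x \<in> N \<Longrightarrow> norm (M *\<^sub>R (F x - p)) \<le> 1/8"
  shows "squashable (F ` N)"
proof -
  define aff where "aff \<sigma> x = (\<sigma> *\<^sub>R n x + M *\<^sub>R (F x - p),
      \<sigma> * (n x \<bullet> F x) + M * ((F x - p) \<bullet> p) + M / 2 * (norm (F x - p))\<^sup>2)" for \<sigma> :: real and x
  have val: "affine_val (aff \<sigma> x) z = \<sigma> * (n x \<bullet> (z - F x)) + M / 2 * (norm (z - p))\<^sup>2 - M / 2 * (norm (z - F x))\<^sup>2"
    for \<sigma> x z
  proof -
    have eq: "(norm (z - F x))\<^sup>2 = (norm (z - p))\<^sup>2 - 2 * ((F x - p) \<bullet> (z - p)) + (norm (F x - p))\<^sup>2"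
      unfolding power2_norm_eq_inner by (simp add: inner_diff_left inner_diff_right inner_commute)
    show ?thesis unfolding aff_def eq
      by (simp add: inner_add_left inner_diff_left inner_diff_right algebra_simps)
  qed
  \<comment> \<open>The gradient of \<open>aff \<sigma> x\<close> is \<open>\<sigma>\<close> times
    the normal plus the small vector \<open>M *\<^sub>R (F x - p)\<close>, so the two signs give
    gradients near \<open>n0\<close> and near \<open>- n0\<close>.\<close>
  have axis: "norm (fst (aff \<sigma> x) - \<sigma> *\<^sub>R n0) \<le> 1/4" if "x \<in> N" "\<bar>\<sigma>\<bar> = 1" for \<sigma> x
  proof -
    have "fst (aff \<sigma> x) - \<sigma> *\<^sub>R n0 = \<sigma> *\<^sub>R (n x - n0) + M *\<^sub>R (F x - p)"
      unfolding aff_def by (simp add: algebra_simps)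
    moreover have "norm (\<sigma> *\<^sub>R (n x - n0)) \<le> 1/8" using near(1)[OF that(1)] that(2) by simp
    ultimately show ?thesis
      using near(2)[OF that(1)] norm_triangle_ineq[of "\<sigma> *\<^sub>R (n x - n0)" "M *\<^sub>R (F x - p)"] by simp
  qed
  show ?thesis
  proof (rule squashable_if_opposed_envelopes[OF comp, of "1/2" "aff 1 ` N" "aff (-1) ` N" 2
        "\<lambda>z. M / 2 * (norm (z - p))\<^sup>2"])
    fix q assume "q \<in> aff 1 ` N \<union> aff (-1) ` N"
    then obtain \<sigma> x where q: "q = aff \<sigma> x" "\<bar>\<sigma>\<bar> = 1" "x \<in> N" by auto
    have "norm (fst q) \<le> norm (fst q - \<sigma> *\<^sub>R n0) + norm (\<sigma> *\<^sub>R n0)"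
      using norm_triangle_ineq[of "fst q - \<sigma> *\<^sub>R n0" "\<sigma> *\<^sub>R n0"] by simp
    then show "norm (fst q) \<le> 2" using axis[OF q(3,2)] q(1,2) \<open>norm n0 = 1\<close> by simp
    fix z assume "z \<in> F ` N"
    then obtain y where y: "y \<in> N" "z = F y" by blast
    have "\<sigma> * (n x \<bullet> (F y - F x)) \<le> \<bar>n x \<bullet> (F y - F x)\<bar>"
      using q(2) abs_ge_self[of "\<sigma> * (n x \<bullet> (F y - F x))"] by (simp add: abs_mult)
    then show "affine_val q z \<le> M / 2 * (norm (z - p))\<^sup>2"
      using tangent[OF q(3) y(1)] unfolding q(1) val y(2) by linarith
  next
    fix z assume "z \<in> F ` N"
    then obtain y where y: "y \<in> N" "z = F y" by blast
    have "affine_val (aff \<sigma> y) z = M / 2 * (norm (z - p))\<^sup>2" for \<sigma> unfolding val y(2) by simp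
    then show "\<exists>q\<in>aff 1 ` N. affine_val q z = M / 2 * (norm (z - p))\<^sup>2"
        "\<exists>q\<in>aff (-1) ` N. affine_val q z = M / 2 * (norm (z - p))\<^sup>2"
      using y(1) by blast+
  next
    fix q r assume "q \<in> aff 1 ` N" "r \<in> aff (-1) ` N"
    then obtain x y where xy: "x \<in> N" "y \<in> N" "q = aff 1 x" "r = aff (-1) y" by blast
    have "norm (fst q - n0) \<le> 1/4" "norm (fst r + n0) \<le> 1/4"
      using axis[OF xy(1), of 1] axis[OF xy(2), of "-1"] xy by simp_all
    then show "fst q \<bullet> (fst q - fst r) \<ge> 1/2" "fst r \<bullet> (fst r - fst q) \<ge> 1/2"
      using opposed_if_near_axis[of n0 "fst q" "fst r"] opposed_if_near_axis[of "- n0" "fst r" "fst q"]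
        \<open>norm n0 = 1\<close> by simp_all
  qed simp
qed

text \<open>A nonzero kernel vector extends to a basis of \<open>V\<close>, and then the image is
  spanned by fewer than \<open>dim V\<close> vectors.\<close>

lemma linear_inj_if_dim_image_eq:
  fixes f :: "'a::euclidean_space \<Rightarrow> 'b::euclidean_space"
  assumes "linear f" "subspace V" "dim (f ` V) = dim V" "z \<in> V" "f z = 0"
  shows "z = 0"
proof (rule ccontr)
  assume "z \<noteq> 0"
  then have "independent {z}" by simp
  then obtain B where B: "{z} \<subseteq> B" "B \<subseteq> V" "independent B" "V \<subseteq> span B"
    using maximal_independent_subset_extend[of "{z}" V] \<open>z \<in> V\<close> by auto
  have fin: "finite B" using B(3) by (rule independent_imp_finite)
  have "f ` V \<subseteq> f ` span B" using B(4) by (rule image_mono)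
  also have "\<dots> = span (f ` B)" using linear_span_image[OF \<open>linear f\<close>] by simp
  also have "f ` B = insert 0 (f ` (B - {z}))" using B(1) \<open>f z = 0\<close> by auto
  also have "span \<dots> = span (f ` (B - {z}))" by simp
  finally have "dim (f ` V) \<le> card (f ` (B - {z}))" using fin by (intro dim_le_card) auto
  also have "\<dots> \<le> card (B - {z})" using fin by (intro card_image_le) simp
  also have "\<dots> < card B" using fin B(1) by (intro psubset_card_mono) auto
  also have "\<dots> = dim V" using B(2-4) by (intro basis_card_eq_dim) auto
  finally show False using assms(3) by simp
qed

text \<open>The Taylor remainder of \<open>F\<close> is quadratic in \<open>y - x\<close>, hence, by
  the lower Lipschitz bound for \<open>F\<close>, quadratic in \<open>F y - F x\<close>. This puts
  the piece outside touching balls of a common size on both sides.\<close>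

lemma good_piece_C2:
  fixes F :: "'a::euclidean_space \<Rightarrow> 'a"
  assumes V: "subspace V" "dim V = DIM('a) - 1" and U: "openin (top_of_set V) U"
    and C2: "C2_with_derivative F F' U"
    and rank: "\<And>x. x \<in> U \<Longrightarrow> dim (blinfun_apply (F' x) ` V) = DIM('a) - 1"
    and u: "u \<in> U"
  obtains \<rho> where "\<rho> > 0" "U \<inter> ball u \<rho> \<subseteq> V \<inter> cball u \<rho>" "good_piece (F ` (V \<inter> cball u \<rho>))"
proof -
  obtain F'' where dF: "\<And>x. x \<in> U \<Longrightarrow> (F has_derivative blinfun_apply (F' x)) (at x within U)"
      and dF': "\<And>x. x \<in> U \<Longrightarrow> (F' has_derivative blinfun_apply (F'' x)) (at x within U)"
      and cont: "continuous_on U F''"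
    using C2 unfolding C2_with_derivative_def by blast
  have UV: "U \<subseteq> V" using U openin_imp_subset by blast
  then have "u \<in> V" using u by blast
  have dimV: "dim V < DIM('a)" using V(2) DIM_positive[where 'a='a] by simp
  obtain c where c: "c > 0" "\<And>z. z \<in> V \<Longrightarrow> norm (F' u z) \<ge> c * norm z"
  proof -
    have "z = 0" if "z \<in> V" "F' u z = 0" for z
      using linear_inj_if_dim_image_eq[of "F' u" V z] that V rank[OF u]
      by (simp add: blinfun.bounded_linear_right bounded_linear.linear)
    then show ?thesis
      using injective_imp_isometric[OF closed_subspace[OF V(1)] V(1), of "F' u"] that
      by (auto simp: blinfun.bounded_linear_right)
  qed
  obtain n0 where n0: "norm n0 = 1" "\<And>z. z \<in> V \<Longrightarrow> n0 \<bullet> F' u z = 0"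
  proof -
    have "dim (F' u ` V) < DIM('a)" using rank[OF u] DIM_positive[where 'a='a] by simp
    then obtain m where m: "m \<noteq> 0" "\<And>y. y \<in> span (F' u ` V) \<Longrightarrow> orthogonal m y"
      using orthogonal_to_subspace_exists by metis
    have "sgn m \<bullet> F' u z = 0" if "z \<in> V" for z
    proof -
      have "F' u z \<in> span (F' u ` V)" using that by (intro span_base) simp
      then show ?thesis using m(2) by (simp add: orthogonal_def sgn_div_norm)
    qed
    then show ?thesis using that[of "sgn m"] m(1) by (simp add: norm_sgn)
  qed
  define K where "K = norm (F'' u) + 1"
  have "K > 0" unfolding K_def by (simp add: add_nonneg_pos)
  \<comment> \<open>Chosen so that \<open>2 * K * r\<^sup>2\<close> equals
    \<open>M / 2 * (c / 2 * r)\<^sup>2\<close>, where 2 bounds the normals and \<open>c / 2\<close>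
    is the lower Lipschitz constant of \<open>F\<close>.\<close>
  define M where "M = 16 * K / c\<^sup>2"
  have "M > 0" unfolding M_def using \<open>K > 0\<close> c(1) by simp
  obtain \<rho>1 where \<rho>1: "\<rho>1 > 0" "V \<inter> cball u \<rho>1 \<subseteq> U"
    using U u unfolding openin_contains_cball by (metis Int_commute)
  have "continuous (at u within U) F''" using cont u by (simp add: continuous_on_eq_continuous_within)
  then obtain \<rho>2 where \<rho>2: "\<rho>2 > 0" "\<And>x. x \<in> U \<Longrightarrow> dist x u < \<rho>2 \<Longrightarrow> dist (F'' x) (F'' u) < 1"
    unfolding continuous_within_eps_delta by (metis zero_less_one)
  have "continuous (at u within U) F" using dF[OF u] by (rule has_derivative_continuous)
  moreover have "1 / (8 * M) > 0" using \<open>M > 0\<close> by simp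
  ultimately obtain \<rho>3 where \<rho>3: "\<rho>3 > 0" "\<And>x. x \<in> U \<Longrightarrow> dist x u < \<rho>3 \<Longrightarrow> dist (F x) (F u) < 1 / (8 * M)"
    unfolding continuous_within_eps_delta by metis
  \<comment> \<open>The four terms keep \<open>N\<close> in \<open>U\<close>, bound
    \<open>F''\<close> by \<open>K\<close>, keep \<open>F\<close> within \<open>1 / (8 * M)\<close>
    of \<open>F u\<close>, and keep \<open>F'\<close> within \<open>c / 16\<close> of
    \<open>F' u\<close>. The halves give strict inequalities on the closed ball.\<close>
  define \<rho> where "\<rho> = min (min \<rho>1 (\<rho>2 / 2)) (min (\<rho>3 / 2) (c / (16 * K)))"
  have \<rho>: "\<rho> > 0" "\<rho> \<le> \<rho>1" "\<rho> < \<rho>2" "\<rho> < \<rho>3" "K * \<rho> \<le> c / 16"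
  proof -
    show "\<rho> > 0" "\<rho> \<le> \<rho>1" "\<rho> < \<rho>2" "\<rho> < \<rho>3"
      unfolding \<rho>_def using \<rho>1(1) \<rho>2(1) \<rho>3(1) c(1) \<open>K > 0\<close> by auto
    have "K * \<rho> \<le> K * (c / (16 * K))" unfolding \<rho>_def using \<open>K > 0\<close> by (intro mult_left_mono) auto
    then show "K * \<rho> \<le> c / 16" using \<open>K > 0\<close> by simp
  qed
  define N where "N = V \<inter> cball u \<rho>"
  have NU: "N \<subseteq> U" unfolding N_def using \<rho>1(2) \<rho>(2) subset_cball[OF \<rho>(2), of u] by blast
  have NV: "N \<subseteq> V" unfolding N_def by simp
  have "convex N" unfolding N_def using V(1) by (intro convex_Int subspace_imp_convex convex_cball)
  have "compact N" unfolding N_def using V(1) by (intro closed_Int_compact closed_subspace compact_cball)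
  have "u \<in> N" unfolding N_def using \<open>u \<in> V\<close> \<rho>(1) by simp
  have distN: "norm (x - u) \<le> \<rho>" if "x \<in> N" for x
    using that unfolding N_def by (simp add: dist_norm norm_minus_commute)
  have dFN: "(F has_derivative blinfun_apply (F' x)) (at x within N)" if "x \<in> N" for x
    using has_derivative_subset[OF dF NU] that NU by blast
  have F'_lip: "norm (F' x - F' y) \<le> K * norm (x - y)" if "x \<in> N" "y \<in> N" for x y
  proof (rule differentiable_bound[OF \<open>convex N\<close> _ _ that])
    fix z assume z: "z \<in> N"
    show "(F' has_derivative blinfun_apply (F'' z)) (at z within N)"
      using has_derivative_subset[OF dF' NU] z NU by blast
    have "dist (F'' z) (F'' u) < 1" using \<rho>2(2)[of z] z NU distN[OF z] \<rho>(3) by (auto simp: dist_norm)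
    then have "norm (F'' z) \<le> K"
      unfolding K_def dist_norm using norm_triangle_ineq2[of "F'' z" "F'' u"] by linarith
    then show "onorm (blinfun_apply (F'' z)) \<le> K" by (simp add: norm_blinfun.rep_eq)
  qed
  have taylor: "norm (F y - F x - F' x (y - x)) \<le> K * (norm (y - x))\<^sup>2" if "x \<in> N" "y \<in> N" for x y
  proof -
    have seg: "closed_segment x y \<subseteq> N" using that \<open>convex N\<close> by (simp add: closed_segment_subset)
    have "norm ((F y - F' x y) - (F x - F' x x)) \<le> (K * norm (y - x)) * norm (y - x)"
    \<comment> \<open>Mean value inequality for \<open>F - F' x\<close>, whose derivative
      \<open>F' z - F' x\<close> is small along the segment because \<open>F'\<close> is
      Lipschitz.\<close>
    proof (rule differentiable_bound[where S = "closed_segment x y" and f' = "\<lambda>z. blinfun_apply (F' z - F' x)"])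
      fix z assume z: "z \<in> closed_segment x y"
      then have "z \<in> N" using seg by blast
      have "(F has_derivative blinfun_apply (F' z)) (at z within closed_segment x y)"
        using has_derivative_subset[OF dFN[OF \<open>z \<in> N\<close>] seg] .
      from has_derivative_diff[OF this bounded_linear_imp_has_derivative[OF blinfun.bounded_linear_right[of "F' x"]]]
      show "((\<lambda>z. F z - F' x z) has_derivative blinfun_apply (F' z - F' x)) (at z within closed_segment x y)"
        by (simp add: blinfun.diff_left[abs_def])
      have "norm (F' z - F' x) \<le> K * norm (z - x)" by (rule F'_lip[OF \<open>z \<in> N\<close> that(1)])
      also have "\<dots> \<le> K * norm (y - x)"
        using segment_bound(1)[OF z] \<open>K > 0\<close> by (intro mult_left_mono) auto
      finally show "onorm (blinfun_apply (F' z - F' x)) \<le> K * norm (y - x)"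
        by (simp add: norm_blinfun.rep_eq)
    qed auto
    then show ?thesis by (simp add: blinfun.diff_right power2_eq_square algebra_simps)
  qed
  have F'_near: "norm (F' x z - F' u z) \<le> c / 16 * norm z" if "x \<in> N" for x z
  proof -
    have "norm (F' x z - F' u z) \<le> norm (F' x - F' u) * norm z"
      using norm_blinfun[of "F' x - F' u" z] by (simp add: blinfun.diff_left)
    also have "norm (F' x - F' u) \<le> K * \<rho>"
      using F'_lip[OF that \<open>u \<in> N\<close>] distN[OF that] \<open>K > 0\<close> by (meson less_imp_le mult_left_mono order_trans)
    then have "norm (F' x - F' u) * norm z \<le> c / 16 * norm z" using \<rho>(5) by (intro mult_right_mono) auto
    finally show ?thesis .
  qed
  have F'_ge: "norm (F' x z) \<ge> 15 / 16 * c * norm z" if "x \<in> N" "z \<in> V" for x z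
    using F'_near[OF that(1), of z] c(2)[OF that(2)] norm_triangle_ineq2[of "F' u z" "F' x z"]
    by (simp add: norm_minus_commute)
  have F_ge: "norm (F y - F x) \<ge> c / 2 * norm (y - x)" if "x \<in> N" "y \<in> N" for x y
  proof -
    have "y - x \<in> V" using that NV V(1) by (auto intro: subspace_diff)
    then have 1: "norm (F' x (y - x)) \<ge> 15 / 16 * c * norm (y - x)" using F'_ge that(1) by blast
    have "norm (y - x) \<le> 2 * \<rho>"
      using distN[OF that(1)] distN[OF that(2)] norm_triangle_ineq4[of "y - u" "x - u"] by simp
    then have "K * norm (y - x) \<le> K * (2 * \<rho>)" using \<open>K > 0\<close> by (intro mult_left_mono) auto
    then have "K * norm (y - x) \<le> c / 8" using \<rho>(5) by linarith
    then have "K * norm (y - x) * norm (y - x) \<le> c / 8 * norm (y - x)" by (intro mult_right_mono) auto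
    then have 2: "norm (F y - F x - F' x (y - x)) \<le> c / 8 * norm (y - x)"
      using taylor[OF that] by (simp add: power2_eq_square)
    have "norm (F' x (y - x)) \<le> norm (F y - F x) + norm (F y - F x - F' x (y - x))"
      using norm_triangle_ineq4[of "F y - F x" "F y - F x - F' x (y - x)"] by simp
    moreover have "c * norm (y - x) \<ge> 0" using c(1) by simp
    ultimately show ?thesis using 1 2 by (simp add: algebra_simps)
  qed
  \<comment> \<open>A normal at \<open>F x\<close> is the part \<open>m\<close> of \<open>n0\<close>
    orthogonal to the tangent space. The tangential part \<open>w = F' x z\<close> is short:
    \<open>n0\<close> is orthogonal to \<open>F' u z\<close>, so the square of the norm of
    \<open>w\<close> is the inner product of \<open>F' x z - F' u z\<close> with
    \<open>n0\<close>.\<close>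
  have "\<exists>m. norm (m - n0) \<le> 1/8 \<and> (\<forall>z\<in>V. m \<bullet> F' x z = 0)" if x: "x \<in> N" for x
  proof -
    obtain w m where wm: "w \<in> span (F' x ` V)" "\<And>y. y \<in> span (F' x ` V) \<Longrightarrow> orthogonal m y" "n0 = w + m"
      using orthogonal_subspace_decomp_exists[where S = "F' x ` V" and x = n0] by metis
    have "linear (blinfun_apply (F' x))"
      by (simp add: blinfun.bounded_linear_right bounded_linear.linear)
    then have span: "span (F' x ` V) = F' x ` V" using V(1) by (simp add: linear_subspace_image span_eq_iff)
    then obtain z where z: "z \<in> V" "w = F' x z" using wm(1) unfolding span by blast
    have "w \<bullet> m = 0" using wm(2)[OF wm(1)] by (simp add: orthogonal_def inner_commute)
    then have "w \<bullet> w = w \<bullet> n0" unfolding wm(3) by (simp add: inner_add_right)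
    moreover have "F' u z \<bullet> n0 = 0" using n0(2)[OF z(1)] by (simp add: inner_commute)
    ultimately have "norm w * norm w = (F' x z - F' u z) \<bullet> n0"
      unfolding z(2)[symmetric] by (simp add: inner_diff_left flip: power2_eq_square power2_norm_eq_inner)
    also have "\<dots> \<le> norm (F' x z - F' u z) * norm n0" by (rule norm_cauchy_schwarz)
    also have "\<dots> \<le> c / 16 * norm z" using F'_near[OF x, of z] n0(1) by simp
    also have "\<dots> \<le> 1/8 * norm w"
    proof -
      have "0 \<le> c * norm z" using c(1) by simp
      moreover have "15 / 16 * (c * norm z) \<le> norm w" using F'_ge[OF x z(1)] z(2) by simp
      ultimately show ?thesis by simp
    qed
    finally have "norm w \<le> 1/8" by (cases "w = 0") (auto simp: mult_le_cancel_right)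
    moreover have "norm (m - n0) = norm w" using wm(3) by simp
    moreover have "m \<bullet> F' x y = 0" if "y \<in> V" for y
      using wm(2)[of "F' x y"] that span by (auto simp: orthogonal_def)
    ultimately show ?thesis by (intro exI[of _ m]) simp
  qed
  then obtain n where n: "\<And>x. x \<in> N \<Longrightarrow> norm (n x - n0) \<le> 1/8"
      "\<And>x z. x \<in> N \<Longrightarrow> z \<in> V \<Longrightarrow> n x \<bullet> F' x z = 0"
    by metis
  have tangent: "\<bar>n x \<bullet> (F y - F x)\<bar> \<le> M / 2 * (norm (F y - F x))\<^sup>2" if "x \<in> N" "y \<in> N" for x y
  proof -
    have "y - x \<in> V" using that NV V(1) by (auto intro: subspace_diff)
    then have "n x \<bullet> (F y - F x) = n x \<bullet> (F y - F x - F' x (y - x))"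
      using n(2)[OF that(1)] by (simp add: inner_diff_right)
    then have "\<bar>n x \<bullet> (F y - F x)\<bar> \<le> norm (n x) * norm (F y - F x - F' x (y - x))"
      by (simp add: Cauchy_Schwarz_ineq2)
    also have "\<dots> \<le> 2 * (K * (norm (y - x))\<^sup>2)"
    proof (rule mult_mono)
      show "norm (n x) \<le> 2" using n(1)[OF that(1)] n0(1) norm_triangle_ineq2[of "n x" n0] by linarith
    qed (use taylor[OF that] in auto)
    also have "\<dots> = M / 2 * (c / 2 * norm (y - x))\<^sup>2"
      unfolding M_def using c(1) by (simp add: field_simps power2_eq_square)
    also have "\<dots> \<le> M / 2 * (norm (F y - F x))\<^sup>2"
      using F_ge[OF that] c(1) \<open>M > 0\<close> by (intro mult_left_mono power_mono) auto
    finally show ?thesis .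
  qed
  have "norm (M *\<^sub>R (F x - F u)) \<le> 1/8" if "x \<in> N" for x
  proof -
    have "dist (F x) (F u) < 1 / (8 * M)"
      using \<rho>3(2)[of x] that NU distN[OF that] \<rho>(4) by (auto simp: dist_norm)
    then have "norm (F x - F u) * (8 * M) < 1" using \<open>M > 0\<close> by (simp add: dist_norm pos_less_divide_eq)
    then show ?thesis using \<open>M > 0\<close> by (simp add: mult.assoc mult.left_commute mult.commute)
  qed
  moreover have "continuous_on N F" using dFN by (rule has_derivative_continuous_on)
  then have comp: "compact (F ` N)" using \<open>compact N\<close> by (rule compact_continuous_image)
  ultimately have "squashable (F ` N)" using squashable_if_tangent_balls[OF comp n0(1) tangent n(1)] by blast
  moreover have "negligible (F ` N)"
  proof (rule negligible_differentiable_image_negligible)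
    show "negligible N" using negligible_lowdim[OF dimV] NV by (rule negligible_subset)
    show "F differentiable_on N" unfolding differentiable_on_def differentiable_def using dFN by blast
  qed simp
  ultimately have "good_piece (F ` N)" using comp unfolding good_piece_def by blast
  moreover have "U \<inter> ball u \<rho> \<subseteq> N" unfolding N_def using UV ball_subset_cball[of u \<rho>] by blast
  ultimately show ?thesis using that \<rho>(1) unfolding N_def by blast
qed

lemma regular_C2_hypersurface_cover:
  fixes S :: "'a::euclidean_space set"
  assumes "regular_C2_hypersurface S"
  obtains \<T> where "countable \<T>" "\<And>T. T \<in> \<T> \<Longrightarrow> good_piece T" "S \<subseteq> \<Union>\<T>"
proof -
  obtain V U and F :: "'a \<Rightarrow> 'a" and F' where V: "subspace V" "dim V = DIM('a) - 1" "openin (top_of_set V) U"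
      "C2_with_derivative F F' U" "\<And>x. x \<in> U \<Longrightarrow> dim (blinfun_apply (F' x) ` V) = DIM('a) - 1"
      and S: "S = F ` U"
    using assms unfolding regular_C2_hypersurface_def by metis
  have "\<exists>W T. open W \<and> u \<in> W \<and> good_piece T \<and> F ` (U \<inter> W) \<subseteq> T" if u: "u \<in> U" for u
  proof -
    obtain \<rho> where "\<rho> > 0" "U \<inter> ball u \<rho> \<subseteq> V \<inter> cball u \<rho>" "good_piece (F ` (V \<inter> cball u \<rho>))"
      using good_piece_C2[OF V u] by metis
    then show ?thesis
      by (intro exI[of _ "ball u \<rho>"] exI[of _ "F ` (V \<inter> cball u \<rho>)"]) (simp add: image_mono)
  qed
  then show ?thesis using countable_cover_from_local[of U good_piece F] that unfolding S by metis
qed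

theorem corollary1p12:
  fixes A :: "'a::euclidean_space set" and \<S> :: "'a set set"
  assumes "bounded A"
    and "countable \<S>"
    and "\<And>S. S \<in> \<S> \<Longrightarrow> convex_hypersurface S \<or> regular_C2_hypersurface S"
    and "frontier A \<subseteq> \<Union>\<S>"
  shows "distance_Kolmogorov A \<and> measure_Kolmogorov A"
proof -
  have "\<exists>\<T>. countable \<T> \<and> (\<forall>T\<in>\<T>. good_piece T) \<and> S \<subseteq> \<Union>\<T>" if "S \<in> \<S>" for S
    using assms(3)[OF that] convex_hypersurface_cover[of S] regular_C2_hypersurface_cover[of S] by metis
  then obtain \<T> where T: "\<And>S. S \<in> \<S> \<Longrightarrow> countable (\<T> S)" "\<And>S T. S \<in> \<S> \<Longrightarrow> T \<in> \<T> S \<Longrightarrow> good_piece T"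
      "\<And>S. S \<in> \<S> \<Longrightarrow> S \<subseteq> \<Union>(\<T> S)" by metis
  show ?thesis
  proof (rule Kolmogorov_if_squashable_cover[OF assms(1), of "\<Union>(\<T> ` \<S>)"])
    show "countable (\<Union>(\<T> ` \<S>))" using assms(2) T(1) by (rule countable_UN)
    show "compact T \<and> squashable T \<and> negligible T" if "T \<in> \<Union>(\<T> ` \<S>)" for T
      using that T(2) unfolding good_piece_def by blast
    show "frontier A \<subseteq> \<Union>(\<Union>(\<T> ` \<S>))"
    proof
      fix x assume "x \<in> frontier A"
      then obtain S where S: "S \<in> \<S>" "x \<in> S" using assms(4) by blast
      then obtain T where "T \<in> \<T> S" "x \<in> T" using T(3)[OF S(1)] by blast
      then show "x \<in> \<Union>(\<Union>(\<T> ` \<S>))" using S(1) by blast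
    qed
  qed
qed

end
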